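(* Let $n\ge 3$ and let $\widehat{M}$ be an $n$-dimensional pseudo-manifold with triangulation $(\widetilde{\Delta},\Phi,p)$. Let $M=\widehat{M}\setminus\widehat{M}^{(0)}$, let $\sigma_0$ be an $n$-simplex of $\widetilde{\Delta}$, and let $x_0$ be the image in $\widehat{M}$ of the barycentre of $\sigma_0$. If the vertices $v$ and $v'$ of $\sigma_0$ have the same image in $\widehat{M}$ under $p\colon\widetilde{\Delta}\to\widehat{M}$, then there is $[\gamma]\in\pi_1(M,x_0)$ with $p_\gamma(v)=v'$. In particular, if an even triangulation has fewer than $n+1$ vertices, then the canonical symmetric representation has non-trivial image, and so the fundamental group of $M$ is non-trivial.
   Context: Triangulations. Let $\widetilde{\Delta}$ be a finite union of pairwise disjoint, oriented Euclidean $n$-simplices. A facet is an $(n-1)$-simplex of $\widetilde\Delta$; for a facet $\tau$, $\sigma_\tau$ is the unique $n$-simplex containing it. Let $\Phi$ be a family of orientation-reversing affine isomorphisms ("face pairings") between facets such that $\varphi\in\Phi$ iff $\varphi^{-1}\in\Phi$ and every facet $\tau$ is the domain of a unique element $\varphi_\tau\in\Phi$. The quotient $\widehat{M}=\widetilde{\Delta}/\Phi$, with quotient map $p$, is a closed orientable $n$-dimensional pseudo-manifold, always assumed connected, and $(\widetilde{\Delta},\Phi,p)$ is a (singular) triangulation of it. The image of a $k$-simplex under $p$ is a $k$-singlex; its degree is the number of $k$-simplices of $\widetilde\Delta$ mapped onto it. The triangulation is even if every $(n-2)$-singlex has even degree. $\widehat{M}^{(k)}$ is the image of the $k$-skeleton;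 the vertices of the triangulation are the points of $\widehat M^{(0)}$. The dual 1-skeleton has a vertex for each $n$-singlex (its barycentre) and an edge for each $(n-1)$-singlex; the dual 2-skeleton has in addition one 2-cell for each $(n-2)$-singlex. Standing convention: $\pi_1(M,x_0)$ is presented with generators represented by loops in the dual 1-skeleton and relators arising from the cells of the dual 2-skeleton. Projectivities. For a facet $\tau$, the perspectivity $p_\tau\colon\sigma_\tau\to\sigma_{\varphi_\tau(\tau)}$ is the bijection of vertex sets sending each vertex $w$ of $\tau$ to $\varphi_\tau(w)$ and the corner opposite $\tau$ to the corner of $\sigma_{\varphi_\tau(\tau)}$ opposite $\varphi_\tau(\tau)$. A loop $\gamma$ in the dual 1-skeleton based at $x_0$ crosses a sequence of facets $\tau_0,\dots,\tau_k$ (with $\tau_0\subset\sigma_0$, and $\tau_{j+1}$ in the same $n$-simplex as $\varphi_{\tau_j}(\tau_j)$), and its projectivity is $p_\gamma=p_{\tau_k}\circ\cdots\circ p_{\tau_0}\in\mathrm{Sym}(\sigma_0)$, a permutation of the vertices of $\sigma_0$. If the triangulation is even, $[\gamma]\mapsto p_\gamma$ is a homomorphism $\pi_1(M,x_0)\to\mathrm{Sym}(\sigma_0)\cong\mathrm{Sym}(n+1)$ (products taken in compatible order), called the canonical symmetric representation. *)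

theory Defs
  imports "HOL-Analysis.Analysis" "HOL-Algebra.Bij" "HOL-Combinatorics.Permutations"
begin

section \<open>Singular triangulations\<close>

text \<open>
  The simplices are solid Euclidean simplices in one ambient Euclidean space.  An orientation
  of a simplex is recorded as the set of its positive vertex orderings.  The family of face
  pairings is indexed by the domain facet: \<open>pairing T \<tau>\<close> is the unique member of the family
  with domain \<open>\<tau>\<close>, and only its values on \<open>\<tau>\<close> matter.
\<close>

record 'a triangulation =
  simplices :: "'a set set"
  orientation :: "'a set \<Rightarrow> 'a list set"
  pairing :: "'a set \<Rightarrow> 'a \<Rightarrow> 'a"

definition verts :: "'a::euclidean_space set \<Rightarrow> 'a set" where
  "verts F = {x. x extreme_point_of F}"

definition barycentre :: "'a::euclidean_space set \<Rightarrow> 'a" where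
  "barycentre F = (\<Sum>v\<in>verts F. v) /\<^sub>R real (card (verts F))"

definition total_space :: "'a triangulation \<Rightarrow> 'a set" where
  "total_space T = \<Union>(simplices T)"

definition ksimplices :: "'a::euclidean_space triangulation \<Rightarrow> nat \<Rightarrow> 'a set set" where
  "ksimplices T k = {F. \<exists>\<sigma>\<in>simplices T. F face_of \<sigma> \<and> aff_dim F = int k}"

definition facets :: "'a::euclidean_space triangulation \<Rightarrow> 'a set set" where
  "facets T = {\<tau>. \<exists>\<sigma>\<in>simplices T. \<tau> facet_of \<sigma>}"

definition simplex_of :: "'a::euclidean_space triangulation \<Rightarrow> 'a set \<Rightarrow> 'a set" where
  "simplex_of T \<tau> = (THE \<sigma>. \<sigma> \<in> simplices T \<and> \<tau> facet_of \<sigma>)"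

definition mate :: "'a::euclidean_space triangulation \<Rightarrow> 'a set \<Rightarrow> 'a set" where
  "mate T \<tau> = pairing T \<tau> ` \<tau>"

definition opposite :: "'a::euclidean_space triangulation \<Rightarrow> 'a set \<Rightarrow> 'a" where
  "opposite T \<tau> = (THE v. v \<in> verts (simplex_of T \<tau>) \<and> v \<notin> \<tau>)"

definition is_orientation :: "'a set \<Rightarrow> 'a list set \<Rightarrow> bool" where
  "is_orientation V Or \<longleftrightarrow>
     (\<exists>xs. distinct xs \<and> set xs = V \<and> Or = {map \<pi> xs | \<pi>. \<pi> permutes V \<and> evenperm \<pi>})"

text \<open>
  The boundary orientation: \<open>(w\<^sub>1, \<dots>, w\<^sub>n)\<close> is positive on the facet opposite \<open>v\<close> iff
  \<open>(v, w\<^sub>1, \<dots>, w\<^sub>n)\<close> is positive on the simplex.  A face pairing is orientation reversing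
  with respect to the boundary orientations of its domain and its range.
\<close>

definition induced_orientation :: "'a::euclidean_space triangulation \<Rightarrow> 'a set \<Rightarrow> 'a list set" where
  "induced_orientation T \<tau> = {ws. opposite T \<tau> # ws \<in> orientation T (simplex_of T \<tau>)}"

definition orientation_reversing :: "'a::euclidean_space triangulation \<Rightarrow> 'a set \<Rightarrow> bool" where
  "orientation_reversing T \<tau> \<longleftrightarrow>
     (\<forall>ws\<in>induced_orientation T \<tau>. map (pairing T \<tau>) ws \<notin> induced_orientation T (mate T \<tau>))"

definition affine_map_on :: "'a::real_vector set \<Rightarrow> ('a \<Rightarrow> 'a) \<Rightarrow> bool" where
  "affine_map_on S f \<longleftrightarrow> (\<exists>h c. linear h \<and> (\<forall>x\<in>S. f x = h x + c))"

definition glued :: "'a::euclidean_space triangulation \<Rightarrow> 'a \<Rightarrow> 'a \<Rightarrow> bool" where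
  "glued T x y \<longleftrightarrow> (\<exists>\<tau>\<in>facets T. x \<in> \<tau> \<and> y = pairing T \<tau> x)"

definition quotient_proj :: "'a::euclidean_space triangulation \<Rightarrow> 'a \<Rightarrow> 'a set" where
  "quotient_proj T x = {y. equivclp (glued T) x y}"

definition quotient_space :: "'a::euclidean_space triangulation \<Rightarrow> 'a set topology" where
  "quotient_space T = topology (\<lambda>U. U \<subseteq> quotient_proj T ` total_space T \<and>
     openin (top_of_set (total_space T)) {x \<in> total_space T. quotient_proj T x \<in> U})"

lemma openin_quotient_space:
  "openin (quotient_space T) U \<longleftrightarrow> U \<subseteq> quotient_proj T ` total_space T \<and>
     openin (top_of_set (total_space T)) {x \<in> total_space T. quotient_proj T x \<in> U}"
proof -
  let ?P = "\<lambda>U. U \<subseteq> quotient_proj T ` total_space T \<and>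
     openin (top_of_set (total_space T)) {x \<in> total_space T. quotient_proj T x \<in> U}"
  have "istopology ?P"
    unfolding istopology_def
  proof (intro conjI allI impI)
    fix A B assume A: "?P A" and B: "?P B"
    have eq: "{x \<in> total_space T. quotient_proj T x \<in> A \<inter> B} =
        {x \<in> total_space T. quotient_proj T x \<in> A} \<inter> {x \<in> total_space T. quotient_proj T x \<in> B}"
      by blast
    show "openin (top_of_set (total_space T)) {x \<in> total_space T. quotient_proj T x \<in> A \<inter> B}"
      unfolding eq using A B by (intro openin_Int) (elim conjE, assumption)+
    show "A \<inter> B \<subseteq> quotient_proj T ` total_space T" using A by auto
  next
    fix \<K> assume K: "\<forall>K\<in>\<K>. ?P K"
    have eq: "{x \<in> total_space T. quotient_proj T x \<in> \<Union>\<K>} =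
        (\<Union>K\<in>\<K>. {x \<in> total_space T. quotient_proj T x \<in> K})"
      by blast
    show "openin (top_of_set (total_space T)) {x \<in> total_space T. quotient_proj T x \<in> \<Union>\<K>}"
      unfolding eq using K by (intro openin_Union) blast
    show "\<Union>\<K> \<subseteq> quotient_proj T ` total_space T" using K by auto
  qed
  then show ?thesis
    by (simp add: quotient_space_def topology_inverse')
qed

lemma quotient_map_quotient_proj:
  "quotient_map (top_of_set (total_space T)) (quotient_space T) (quotient_proj T)"
proof -
  have "topspace (quotient_space T) = quotient_proj T ` total_space T"
  proof
    show "topspace (quotient_space T) \<subseteq> quotient_proj T ` total_space T"
      using openin_topspace[of "quotient_space T"] unfolding openin_quotient_space
      by (elim conjE)
    have "openin (quotient_space T) (quotient_proj T ` total_space T)"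
    proof -
      have "{x \<in> total_space T. quotient_proj T x \<in> quotient_proj T ` total_space T} = total_space T"
        by blast
      then show ?thesis
        unfolding openin_quotient_space by simp
    qed
    then show "quotient_proj T ` total_space T \<subseteq> topspace (quotient_space T)"
      by (rule openin_subset)
  qed
  then show ?thesis
    unfolding quotient_map_def by (simp add: openin_quotient_space)
qed

definition is_triangulation :: "nat \<Rightarrow> 'a::euclidean_space triangulation \<Rightarrow> bool" where
  "is_triangulation n T \<longleftrightarrow>
     finite (simplices T) \<and> pairwise disjnt (simplices T) \<and>
     (\<forall>\<sigma>\<in>simplices T. int n simplex \<sigma> \<and> is_orientation (verts \<sigma>) (orientation T \<sigma>)) \<and>
     (\<forall>\<tau>\<in>facets T.
        mate T \<tau> \<in> facets T \<and>
        affine_map_on \<tau> (pairing T \<tau>) \<and>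
        (\<forall>x\<in>\<tau>. pairing T (mate T \<tau>) (pairing T \<tau> x) = x) \<and>
        orientation_reversing T \<tau>) \<and>
     connected_space (quotient_space T)"

definition singlexes :: "'a::euclidean_space triangulation \<Rightarrow> nat \<Rightarrow> 'a set set set" where
  "singlexes T k = (\<lambda>F. quotient_proj T ` F) ` ksimplices T k"

definition singlex_degree :: "'a::euclidean_space triangulation \<Rightarrow> nat \<Rightarrow> 'a set set \<Rightarrow> nat" where
  "singlex_degree T k S = card {F \<in> ksimplices T k. quotient_proj T ` F = S}"

definition even_triangulation :: "nat \<Rightarrow> 'a::euclidean_space triangulation \<Rightarrow> bool" where
  "even_triangulation n T \<longleftrightarrow> (\<forall>S\<in>singlexes T (n - 2). even (singlex_degree T (n - 2) S))"

definition skeleton :: "'a::euclidean_space triangulation \<Rightarrow> nat \<Rightarrow> 'a set set" where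
  "skeleton T k = quotient_proj T ` (\<Union>j\<le>k. \<Union>(ksimplices T j))"

definition punctured_space :: "'a::euclidean_space triangulation \<Rightarrow> 'a set topology" where
  "punctured_space T = subtopology (quotient_space T) (topspace (quotient_space T) - skeleton T 0)"


section \<open>Loops in the dual 1-skeleton\<close>

text \<open>
  A path in the dual 1-skeleton is given by the list of the facets it crosses; the facets
  \<open>\<tau>\<close> and \<open>mate T \<tau>\<close> stand for the two directions of travel along the edge dual to their
  common image.
\<close>

fun dual_path :: "'a::euclidean_space triangulation \<Rightarrow> 'a set \<Rightarrow> 'a set list \<Rightarrow> 'a set \<Rightarrow> bool" where
  "dual_path T \<sigma> [] \<sigma>' \<longleftrightarrow> \<sigma>' = \<sigma>"
| "dual_path T \<sigma> (\<tau> # \<gamma>) \<sigma>' \<longleftrightarrow> \<tau> facet_of \<sigma> \<and> dual_path T (simplex_of T (mate T \<tau>)) \<gamma> \<sigma>'"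

definition dual_loops :: "'a::euclidean_space triangulation \<Rightarrow> 'a set \<Rightarrow> 'a set list set" where
  "dual_loops T \<sigma> = {\<gamma>. dual_path T \<sigma> \<gamma> \<sigma>}"

definition dual_edge :: "'a::euclidean_space triangulation \<Rightarrow> 'a set \<Rightarrow> real \<Rightarrow> 'a set" where
  "dual_edge T \<tau> t =
     quotient_proj T
       (if t \<le> 1/2 then linepath (barycentre (simplex_of T \<tau>)) (barycentre \<tau>) (2 * t)
        else linepath (barycentre (mate T \<tau>)) (barycentre (simplex_of T (mate T \<tau>))) (2 * t - 1))"

fun dual_curve :: "'a::euclidean_space triangulation \<Rightarrow> 'a set \<Rightarrow> 'a set list \<Rightarrow> real \<Rightarrow> 'a set" where
  "dual_curve T \<sigma> [] t = quotient_proj T (barycentre \<sigma>)"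
| "dual_curve T \<sigma> (\<tau> # \<gamma>) t =
     (if t \<le> 1/2 then dual_edge T \<tau> (2 * t)
      else dual_curve T (simplex_of T (mate T \<tau>)) \<gamma> (2 * t - 1))"

definition loop_in :: "'b topology \<Rightarrow> 'b \<Rightarrow> (real \<Rightarrow> 'b) \<Rightarrow> bool" where
  "loop_in X x g \<longleftrightarrow> pathin X g \<and> g 0 = x \<and> g 1 = x"


section \<open>Projectivities\<close>

definition perspectivity :: "'a::euclidean_space triangulation \<Rightarrow> 'a set \<Rightarrow> 'a \<Rightarrow> 'a" where
  "perspectivity T \<tau> =
     (\<lambda>w\<in>verts (simplex_of T \<tau>). if w \<in> \<tau> then pairing T \<tau> w else opposite T (mate T \<tau>))"

fun projectivity :: "'a::euclidean_space triangulation \<Rightarrow> 'a set \<Rightarrow> 'a set list \<Rightarrow> 'a \<Rightarrow> 'a" where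
  "projectivity T \<sigma> [] = (\<lambda>w\<in>verts \<sigma>. w)"
| "projectivity T \<sigma> (\<tau> # \<gamma>) =
     compose (verts \<sigma>) (projectivity T (simplex_of T (mate T \<tau>)) \<gamma>) (perspectivity T \<tau>)"


section \<open>The fundamental group\<close>

text \<open>
  Let \<open>e\<close> be an \<open>(n - 2)\<close>-face of the facet \<open>\<tau>\<close>.  Turning around \<open>e\<close> means crossing \<open>\<tau>\<close> and
  leaving the next simplex through its other facet containing the image of \<open>e\<close>.  The facets
  crossed up to the first return to \<open>\<tau>\<close> and, pointwise, to \<open>e\<close> form the boundary of the 2-cell
  dual to the image of \<open>e\<close>.  Pointwise return matters only if \<open>e\<close> is glued to itself by a
  nontrivial symmetry; the curve described is then a small circle around the image of a
  generic point of \<open>e\<close>.  Letting \<open>(\<tau>, e)\<close> vary yields all starting points and both directions.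
\<close>

definition other_facet :: "'a::euclidean_space triangulation \<Rightarrow> 'a set \<Rightarrow> 'a set \<Rightarrow> 'a set" where
  "other_facet T \<tau> e = (THE \<rho>. \<rho> facet_of simplex_of T \<tau> \<and> e \<subseteq> \<rho> \<and> \<rho> \<noteq> \<tau>)"

definition turn :: "'a::euclidean_space triangulation \<Rightarrow> 'a set \<times> 'a set \<Rightarrow> 'a set \<times> 'a set" where
  "turn T = (\<lambda>(\<tau>, e). (other_facet T (mate T \<tau>) (pairing T \<tau> ` e), pairing T \<tau> ` e))"

definition turn_walk :: "'a::euclidean_space triangulation \<Rightarrow> 'a set \<Rightarrow> 'a set \<Rightarrow> nat \<Rightarrow> 'a set list" where
  "turn_walk T \<tau> e m = map (\<lambda>j. fst ((turn T ^^ j) (\<tau>, e))) [0..<m]"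

definition turn_closes :: "'a::euclidean_space triangulation \<Rightarrow> 'a set \<Rightarrow> 'a set \<Rightarrow> nat \<Rightarrow> bool" where
  "turn_closes T \<tau> e m \<longleftrightarrow>
     0 < m \<and> (turn T ^^ m) (\<tau>, e) = (\<tau>, e) \<and>
     (\<forall>x\<in>e. fold (pairing T) (turn_walk T \<tau> e m) x = x)"

definition cell_boundaries :: "nat \<Rightarrow> 'a::euclidean_space triangulation \<Rightarrow> 'a set list set" where
  "cell_boundaries n T =
     {turn_walk T \<tau> e m | \<tau> e m.
        \<tau> \<in> facets T \<and> e face_of \<tau> \<and> aff_dim e = int n - 2 \<and>
        turn_closes T \<tau> e m \<and> (\<forall>k<m. \<not> turn_closes T \<tau> e k)}"

text \<open>
  The group presented by the dual 2-skeleton: loops in the dual 1-skeleton modulo deletion and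
  insertion of backtracking and of boundaries of dual 2-cells.  By convention this is the
  group \<open>\<pi>\<^sub>1(M, x\<^sub>0)\<close> of the punctured space \<open>M\<close>.  For \<open>n \<ge> 4\<close> the topological fundamental group
  of \<open>M\<close> can be a proper quotient of it, because links of simplices of codimension at least
  three need not be simply connected.
\<close>

inductive elementary_move ::
    "nat \<Rightarrow> 'a::euclidean_space triangulation \<Rightarrow> 'a set list \<Rightarrow> 'a set list \<Rightarrow> bool" for n T where
  backtrack: "\<tau> \<in> facets T \<Longrightarrow> elementary_move n T (\<alpha> @ [\<tau>, mate T \<tau>] @ \<beta>) (\<alpha> @ \<beta>)"
| cell: "\<zeta> \<in> cell_boundaries n T \<Longrightarrow> elementary_move n T (\<alpha> @ \<zeta> @ \<beta>) (\<alpha> @ \<beta>)"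

definition loop_equiv ::
    "nat \<Rightarrow> 'a::euclidean_space triangulation \<Rightarrow> 'a set \<Rightarrow> ('a set list \<times> 'a set list) set" where
  "loop_equiv n T \<sigma> =
     {(\<gamma>, \<delta>). \<gamma> \<in> dual_loops T \<sigma> \<and>
        equivclp (\<lambda>a b. a \<in> dual_loops T \<sigma> \<and> b \<in> dual_loops T \<sigma> \<and> elementary_move n T a b) \<gamma> \<delta>}"

definition loop_class ::
    "nat \<Rightarrow> 'a::euclidean_space triangulation \<Rightarrow> 'a set \<Rightarrow> 'a set list \<Rightarrow> 'a set list set" where
  "loop_class n T \<sigma> \<gamma> = loop_equiv n T \<sigma> `` {\<gamma>}"

text \<open>
  The product \<open>[\<gamma>] [\<delta>]\<close> is the class of the loop that runs through \<open>\<delta>\<close> first and then through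
  \<open>\<gamma>\<close>, matching the composition of functions in \<^const>\<open>BijGroup\<close>.
\<close>

definition pi1 ::
    "nat \<Rightarrow> 'a::euclidean_space triangulation \<Rightarrow> 'a set \<Rightarrow> 'a set list set monoid" where
  "pi1 n T \<sigma> =
     \<lparr>carrier = dual_loops T \<sigma> // loop_equiv n T \<sigma>,
      mult = (\<lambda>A B. \<Union>\<gamma>\<in>A. \<Union>\<delta>\<in>B. loop_class n T \<sigma> (\<delta> @ \<gamma>)),
      one = loop_class n T \<sigma> []\<rparr>"

definition canonical_rep ::
    "'a::euclidean_space triangulation \<Rightarrow> 'a set \<Rightarrow> 'a set list set \<Rightarrow> 'a \<Rightarrow> 'a" where
  "canonical_rep T \<sigma> A = the_elem (projectivity T \<sigma> ` A)"

end

theory Submission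
  imports Defs
begin

text \<open>
  Gluing a point along a facet is tracked by the perspectivity of that facet.  Hence a chain of
  gluings that identifies two vertices \<open>v\<close>, \<open>v'\<close> of one simplex is itself a path in the dual
  1-skeleton, and since the simplices are disjoint it closes up to a loop whose projectivity maps
  \<open>v\<close> to \<open>v'\<close>.

  When one turns around an \<open>(n - 2)\<close>-face, each step interchanges the roles of the two vertices off
  that face, so the projectivity around a dual 2-cell is trivial iff the number of steps is even.
  The number of steps is a multiple of the size of the turning orbit, and evenness of the degrees
  makes this size even.
\<close>

section \<open>Faces of simplices and affine maps\<close>

text \<open>Turning is analysed on flags, pairs of a facet and an (n-2)-face of it. There it is the
  composite of two involutions, crossing the facet and switching to the other facet of the same
  simplex through the same face, so the inverse turn and the dihedral relations are available. The
  obstacle is that a degree counts faces by their images as point sets in the quotient, while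
  turning moves flags. The two are compared through barycentres: pairings preserve them, and a facet
  that contains the barycentre of a face contains the whole face, so a chain of gluings of this one
  point is a sequence of turns forwards and backwards. Flags and faces may still differ in number,
  because an orbit can contain both flags of a face inside one simplex. Parity says nothing about
  the vertices on the face itself; these are fixed because a dual 2-cell closes only at a pointwise
  return to the face.\<close>

lemma verts_convex_hull_affine_independent:
  "\<not> affine_dependent C \<Longrightarrow> verts (convex hull C) = C"
  by (simp add: verts_def extreme_point_of_convex_hull_affine_independent)

lemma simplex_verts:
  assumes "k simplex F"
  shows "finite (verts F)" "\<not> affine_dependent (verts F)" "convex hull (verts F) = F"
    "int (card (verts F)) = k + 1"
proof -
  obtain C where "\<not> affine_dependent C" "int (card C) = k + 1" "F = convex hull C"
    using assms by (auto simp: simplex_def)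
  then show "finite (verts F)" "\<not> affine_dependent (verts F)" "convex hull (verts F) = F"
    "int (card (verts F)) = k + 1"
    by (auto simp: verts_convex_hull_affine_independent aff_independent_finite)
qed

lemma
  assumes "k simplex F" "c \<subseteq> verts F"
  shows verts_convex_hull_subset: "verts (convex hull c) = c"
    and convex_hull_subset_simplex: "(int (card c) - 1) simplex (convex hull c)"
proof -
  have c: "\<not> affine_dependent c"
    using affine_dependent_subset simplex_verts(2)[OF assms(1)] assms(2) by blast
  show "verts (convex hull c) = c"
    using c by (rule verts_convex_hull_affine_independent)
  show "(int (card c) - 1) simplex (convex hull c)"
    using c by (intro simplex_convex_hull) auto
qed

lemma
  assumes "k simplex F" "G face_of F"
  shows verts_face_subset: "verts G \<subseteq> verts F"
    and face_of_simplex_simplex: "(int (card (verts G)) - 1) simplex G"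
    and aff_dim_face_of_simplex: "aff_dim G = int (card (verts G)) - 1"
    and verts_face_eq: "verts G = verts F \<inter> G"
proof -
  show 1: "verts G \<subseteq> verts F"
    using extreme_point_of_face[OF assms(2)] by (auto simp: verts_def)
  obtain c where c: "c \<subseteq> verts F" "G = convex hull c"
    using assms face_of_convex_hull_affine_independent[OF simplex_verts(2)[OF assms(1)], of G]
    by (auto simp: simplex_verts(3)[OF assms(1)])
  show 2: "(int (card (verts G)) - 1) simplex G"
    using convex_hull_subset_simplex[OF assms(1) c(1)] verts_convex_hull_subset[OF assms(1) c(1)] c(2)
    by simp
  then show "aff_dim G = int (card (verts G)) - 1"
    by (rule aff_dim_simplex)
  show "verts G = verts F \<inter> G"
    using extreme_point_of_face[OF assms(2)] by (auto simp: verts_def)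
qed

lemma facet_of_simplexE:
  assumes "k simplex F" "\<tau> facet_of F"
  obtains a where "a \<in> verts F" "a \<notin> \<tau>" "verts \<tau> = verts F - {a}"
proof -
  obtain a where a: "a \<in> verts F" "\<tau> = convex hull (verts F - {a})"
    using assms facet_of_convex_hull_affine_independent[OF simplex_verts(2)[OF assms(1)], of \<tau>]
    by (auto simp: simplex_verts(3)[OF assms(1)])
  moreover have v: "verts \<tau> = verts F - {a}"
    using verts_convex_hull_subset[OF assms(1), of "verts F - {a}"] a by auto
  moreover have "verts \<tau> = verts F \<inter> \<tau>"
    using verts_face_eq[OF assms(1) facet_of_imp_face_of[OF assms(2)]] .
  ultimately have "a \<notin> \<tau>" by blast
  with a v show thesis by (intro that) auto
qed

lemma convex_hull_facet_of_simplex: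
  assumes "k simplex F" "0 < k" "a \<in> verts F"
  shows "convex hull (verts F - {a}) facet_of F"
proof -
  \<comment> \<open>Facets are nonempty by definition, so a second vertex is needed;
    \<open>0 < k\<close> provides it.\<close>
  have "verts F - {a} \<noteq> {}"
    using simplex_verts(4)[OF assms(1)] assms(2,3) card_le_Suc0_iff_eq[OF simplex_verts(1)[OF assms(1)]]
    by (metis Diff_eq_empty_iff One_nat_def add_cancel_left_left card.empty card.insert empty_iff finite.emptyI insert_absorb nat_neq_iff of_nat_1 subset_singletonD less_irrefl of_nat_0)
  then show ?thesis
    using facet_of_convex_hull_affine_independent[OF simplex_verts(2)[OF assms(1)]]
      assms(3) simplex_verts(3)[OF assms(1)] by auto
qed

lemma face_of_simplex_subset_iff:
  assumes "k simplex F" "G face_of F" "H face_of F"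
  shows "G \<subseteq> H \<longleftrightarrow> verts G \<subseteq> verts H"
proof
  show "verts G \<subseteq> verts H" if "G \<subseteq> H"
    using that verts_face_eq[OF assms(1,2)] verts_face_eq[OF assms(1,3)] by auto
  show "G \<subseteq> H" if "verts G \<subseteq> verts H"
    using hull_mono[OF that, of convex]
    by (simp add: simplex_verts(3)[OF face_of_simplex_simplex[OF assms(1,2)]]
        simplex_verts(3)[OF face_of_simplex_simplex[OF assms(1,3)]])
qed

lemma barycentre_in_rel_interior:
  assumes "k simplex F" "0 \<le> k"
  shows "barycentre F \<in> rel_interior F"
proof -
  have card: "card (verts F) > 0" using simplex_verts(4)[OF assms(1)] assms(2) by linarith
  \<comment> \<open>Over affinely independent points the relative interior consists of the
    combinations with positive weights; here all weights are equal.\<close>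
  have "(\<Sum>v\<in>verts F. (1 / real (card (verts F))) *\<^sub>R v) = barycentre F"
    by (simp add: barycentre_def scaleR_sum_right divide_inverse)
  then have "barycentre F \<in> rel_interior (convex hull verts F)"
    using card unfolding rel_interior_convex_hull_explicit[OF simplex_verts(2)[OF assms(1)]]
    by (auto intro!: exI[of _ "\<lambda>_. 1 / real (card (verts F))"])
  then show ?thesis by (simp add: simplex_verts(3)[OF assms(1)])
qed

lemma barycentre_mem: "k simplex F \<Longrightarrow> 0 \<le> k \<Longrightarrow> barycentre F \<in> F"
  using barycentre_in_rel_interior rel_interior_subset by blast

text \<open>A face that meets the relative interior of a convex subset contains that subset. This
  turns incidence of one point with a facet into incidence of a whole (n-2)-face.\<close>

lemma face_subset_if_barycentre_mem:
  assumes "k simplex F" "0 \<le> k" "F \<subseteq> S" "G face_of S" "barycentre F \<in> G"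
  shows "F \<subseteq> G"
  using subset_of_face_of[OF assms(4,3)] barycentre_in_rel_interior[OF assms(1,2)] assms(5) by auto

text \<open>Otherwise the singleton of the barycentre would be a face of \<open>S\<close> meeting
  the relative interior of \<open>F\<close>, hence containing \<open>F\<close>, which has positive
  dimension. This keeps the corners of dual curves away from the vertices.\<close>

lemma barycentre_not_vertex:
  assumes "k simplex F" "1 \<le> k" "F \<subseteq> S"
  shows "barycentre F \<notin> verts S"
proof
  assume "barycentre F \<in> verts S"
  then have "F \<subseteq> {barycentre F}"
    using face_subset_if_barycentre_mem[of k F S "{barycentre F}"] assms
    by (auto simp: verts_def face_of_singleton)
  then show False
    using aff_dim_simplex[OF assms(1)] aff_dim_subset[of F "{barycentre F}"] assms(2) by simp
qed

lemma affine_map_on_combination: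
  assumes "affine_map_on S f" "convex S" "a \<in> S" "b \<in> S" "0 \<le> u" "u \<le> 1"
  shows "f ((1 - u) *\<^sub>R a + u *\<^sub>R b) = (1 - u) *\<^sub>R f a + u *\<^sub>R f b"
proof -
  obtain h c where h: "linear h" "\<And>x. x \<in> S \<Longrightarrow> f x = h x + c"
    using assms(1) by (auto simp: affine_map_on_def)
  have "(1 - u) *\<^sub>R a + u *\<^sub>R b \<in> S"
    using assms by (auto simp: convex_alt)
  then show ?thesis
    using h assms(3,4) by (simp add: linear_add linear_scale scaleR_add_right flip: scaleR_add_left)
qed

lemma convex_affine_image:
  assumes "affine_map_on S f" "convex S" "G \<subseteq> S" "convex G"
  shows "convex (f ` G)"
  unfolding convex_alt
proof (clarsimp)
  fix x y u assume *: "x \<in> G" "y \<in> G" "0 \<le> (u::real)" "u \<le> 1"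
  then have "(1 - u) *\<^sub>R x + u *\<^sub>R y \<in> G" using assms(4) by (auto simp: convex_alt)
  then show "(1 - u) *\<^sub>R f x + u *\<^sub>R f y \<in> f ` G"
    using affine_map_on_combination[OF assms(1,2), of x y u] * assms(3) by (metis imageI subsetD)
qed

text \<open>Injectivity pulls a point strictly between two image points back to a point strictly
  between their preimages, where the face property of \<open>G\<close> applies.\<close>

lemma face_of_affine_image:
  assumes f: "affine_map_on S f" "inj_on f S" "convex S" and G: "G face_of S"
  shows "f ` G face_of f ` S"
  unfolding face_of_def
proof (intro conjI ballI impI)
  have GS: "G \<subseteq> S" "convex G" using G by (auto simp: face_of_def)
  show "f ` G \<subseteq> f ` S" using GS by auto
  show "convex (f ` G)" using convex_affine_image[OF f(1,3) GS] .
  fix a' b' x' assume "a' \<in> f ` S" "b' \<in> f ` S" "x' \<in> f ` G" and seg: "x' \<in> open_segment a' b'"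
  then obtain a b x where ab: "a \<in> S" "b \<in> S" "x \<in> G" "a' = f a" "b' = f b" "x' = f x" by auto
  obtain u where u: "0 < u" "u < 1" "f x = (1 - u) *\<^sub>R f a + u *\<^sub>R f b" "f a \<noteq> f b"
    using seg ab by (auto simp: in_segment)
  have "f x = f ((1 - u) *\<^sub>R a + u *\<^sub>R b)"
    using affine_map_on_combination[OF f(1,3) ab(1,2), of u] u by simp
  moreover have "(1 - u) *\<^sub>R a + u *\<^sub>R b \<in> S"
    using f(3) ab u by (auto simp: convex_alt)
  ultimately have "x = (1 - u) *\<^sub>R a + u *\<^sub>R b"
    using f(2) ab GS by (auto dest: inj_onD)
  then have "x \<in> open_segment a b"
    using u by (auto simp: in_segment)
  then have "a \<in> G" "b \<in> G"
    using G ab(1-3) by (auto simp: face_of_def)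
  then show "a' \<in> f ` G" "b' \<in> f ` G"
    using ab by auto
qed

text \<open>The translation part is added once per vertex, and division by the number of vertices
  reduces it to a single translation.\<close>

lemma barycentre_affine_image:
  assumes f: "affine_map_on F f" "inj_on f F" and "verts (f ` F) = f ` verts F"
    "k simplex F" "0 \<le> k"
  shows "barycentre (f ` F) = f (barycentre F)"
proof -
  obtain h c where h: "linear h" "\<And>x. x \<in> F \<Longrightarrow> f x = h x + c"
    using f(1) by (auto simp: affine_map_on_def)
  have sub: "verts F \<subseteq> F" by (auto simp: verts_def extreme_point_of_def)
  have inj: "inj_on f (verts F)" using inj_on_subset[OF f(2) sub] .
  have card: "card (verts F) > 0" using simplex_verts(4)[OF assms(4)] assms(5) by linarith
  have "(\<Sum>v\<in>verts F. f v) = (\<Sum>v\<in>verts F. h v + c)"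
    using h sub by (intro sum.cong) auto
  then have "(\<Sum>v\<in>verts F. f v) = h (\<Sum>v\<in>verts F. v) + real (card (verts F)) *\<^sub>R c"
    by (simp add: sum.distrib linear_sum[OF h(1)] sum_constant_scaleR)
  then show ?thesis
    using h(2)[OF barycentre_mem[OF assms(4,5)]] inj card
    by (simp add: barycentre_def assms(3) sum.reindex card_image linear_scale[OF h(1)] scaleR_add_right)
qed

text \<open>The set splits into pairs, removed one at a time. The later application is to a turning
  orbit stable under \<open>flip\<close>.\<close>

lemma even_card_involution:
  assumes "finite X" "\<And>x. x \<in> X \<Longrightarrow> h x \<in> X" "\<And>x. x \<in> X \<Longrightarrow> h (h x) = x" "\<And>x. x \<in> X \<Longrightarrow> h x \<noteq> x"
  shows "even (card X)"
  using assms
proof (induction "card X" arbitrary: X rule: less_induct)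
  case less
  show ?case
  proof (cases "X = {}")
    case False
    then obtain x where x: "x \<in> X" by blast
    have hx: "h x \<in> X" "h x \<noteq> x" "h (h x) = x" using less.prems x by auto
    have "card X = card (X - {x, h x}) + 2"
      using card_Diff_subset[of "{x, h x}" X] card_mono[of X "{x, h x}"] less.prems(1) x hx by auto
    moreover have "even (card (X - {x, h x}))"
    proof (rule less.hyps)
      show "card (X - {x, h x}) < card X" using calculation by simp
      show "h y \<in> X - {x, h x}" if "y \<in> X - {x, h x}" for y
        using that less.prems hx by (metis Diff_iff insert_iff singletonD)
    qed (use less.prems in auto)
    ultimately show ?thesis by simp
  qed simp
qed

text \<open>The parametrisation is the one used in \<open>dual_edge\<close> and
  \<open>dual_curve\<close>.\<close>

lemma pathin_join:
  assumes "pathin X g" "pathin X h" "g 1 = h 0"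
  shows "pathin X (\<lambda>t. if t \<le> 1/2 then g (2 * t) else h (2 * t - 1))"
  unfolding pathin_def
proof (rule continuous_map_cases_le)
  show "continuous_map (subtopology (top_of_set {0..1}) {x \<in> topspace (top_of_set {0..1}). x \<le> 1/2}) X (\<lambda>t::real. g (2 * t))"
    using assms(1) unfolding pathin_def subtopology_subtopology
    by (rule continuous_map_compose[unfolded o_def, rotated])
       (auto simp: continuous_map_in_subtopology intro!: continuous_intros)
  show "continuous_map (subtopology (top_of_set {0..1}) {x \<in> topspace (top_of_set {0..1}). 1/2 \<le> x}) X (\<lambda>t::real. h (2 * t - 1))"
    using assms(2) unfolding pathin_def subtopology_subtopology
    by (rule continuous_map_compose[unfolded o_def, rotated])
       (auto simp: continuous_map_in_subtopology intro!: continuous_intros)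
  show "g (2 * t) = h (2 * t - 1)" if "t = 1/2" for t
    unfolding that using assms(3) by simp
qed (auto intro!: continuous_intros)

section \<open>Perspectivities and dual paths\<close>

lemma verts_mem: "x \<in> verts F \<Longrightarrow> x \<in> F"
  by (simp add: verts_def extreme_point_of_def)

lemma dual_path_append:
  "dual_path T \<sigma> (\<alpha> @ \<beta>) \<sigma>' \<longleftrightarrow> (\<exists>\<rho>. dual_path T \<sigma> \<alpha> \<rho> \<and> dual_path T \<rho> \<beta> \<sigma>')"
  by (induction \<alpha> arbitrary: \<sigma>) auto

lemma projectivity_extensional: "projectivity T \<sigma> \<gamma> \<in> extensional (verts \<sigma>)"
  by (cases \<gamma>) auto

lemma topspace_quotient_space: "topspace (quotient_space T) = quotient_proj T ` total_space T"
  using quotient_map_quotient_proj[of T] by (simp add: quotient_map_def)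

lemma dual_path_unique: "dual_path T \<sigma> \<alpha> \<rho> \<Longrightarrow> dual_path T \<sigma> \<alpha> \<rho>' \<Longrightarrow> \<rho> = \<rho>'"
  by (induction \<alpha> arbitrary: \<sigma>) auto

locale triangulated =
  fixes n :: nat and T :: "'a::euclidean_space triangulation"
  assumes n_ge_3: "3 \<le> n" and T: "is_triangulation n T"
begin

section \<open>Facets, their simplices and their opposite corners\<close>

lemma finite_simplices: "finite (simplices T)"
  using T by (simp add: is_triangulation_def)

lemma simplex: "\<sigma> \<in> simplices T \<Longrightarrow> int n simplex \<sigma>"
  using T by (simp add: is_triangulation_def)

lemma simplices_eq: "\<sigma> \<in> simplices T \<Longrightarrow> \<rho> \<in> simplices T \<Longrightarrow> x \<in> \<sigma> \<Longrightarrow> x \<in> \<rho> \<Longrightarrow> \<sigma> = \<rho>"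
  using T by (auto simp: is_triangulation_def pairwise_def disjnt_def)

text \<open>Facets are nonempty and distinct simplices are disjoint, so a single point of the facet
  decides which simplex contains it.\<close>

lemma simplex_of_eq:
  assumes "\<sigma> \<in> simplices T" "\<tau> facet_of \<sigma>"
  shows "simplex_of T \<tau> = \<sigma>"
  unfolding simplex_of_def
proof (rule the_equality)
  fix \<rho> assume \<rho>: "\<rho> \<in> simplices T \<and> \<tau> facet_of \<rho>"
  obtain x where "x \<in> \<tau>" using assms(2) by (auto simp: facet_of_def)
  then show "\<rho> = \<sigma>"
    using \<rho> assms simplices_eq[of \<rho> \<sigma> x] facet_of_imp_subset by blast
qed (use assms in auto)

lemma facets_iff: "\<tau> \<in> facets T \<longleftrightarrow> simplex_of T \<tau> \<in> simplices T \<and> \<tau> facet_of simplex_of T \<tau>"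
  using simplex_of_eq by (auto simp: facets_def)

lemma facetsI: "\<sigma> \<in> simplices T \<Longrightarrow> \<tau> facet_of \<sigma> \<Longrightarrow> \<tau> \<in> facets T"
  by (auto simp: facets_def)

lemma simplex_of_simplices: "\<tau> \<in> facets T \<Longrightarrow> simplex_of T \<tau> \<in> simplices T"
  and facet_of_simplex_of: "\<tau> \<in> facets T \<Longrightarrow> \<tau> facet_of simplex_of T \<tau>"
  and face_of_simplex_of: "\<tau> \<in> facets T \<Longrightarrow> \<tau> face_of simplex_of T \<tau>"
  by (auto simp: facets_iff facet_of_imp_face_of)

lemma facet_subset: "\<tau> \<in> facets T \<Longrightarrow> x \<in> \<tau> \<Longrightarrow> x \<in> simplex_of T \<tau>"
  using facet_of_simplex_of facet_of_imp_subset by blast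

lemma simplex_of_eq_if_mem:
  "\<tau> \<in> facets T \<Longrightarrow> x \<in> \<tau> \<Longrightarrow> \<sigma> \<in> simplices T \<Longrightarrow> x \<in> \<sigma> \<Longrightarrow> simplex_of T \<tau> = \<sigma>"
  using facet_subset simplex_of_simplices simplices_eq by blast

lemma opposite:
  assumes "\<tau> \<in> facets T"
  shows "opposite T \<tau> \<in> verts (simplex_of T \<tau>)" "opposite T \<tau> \<notin> \<tau>"
    "verts \<tau> = verts (simplex_of T \<tau>) - {opposite T \<tau>}"
proof -
  obtain a where a: "a \<in> verts (simplex_of T \<tau>)" "a \<notin> \<tau>" "verts \<tau> = verts (simplex_of T \<tau>) - {a}"
    using facet_of_simplexE[OF simplex[OF simplex_of_simplices[OF assms]] facet_of_simplex_of[OF assms]] .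
  have "opposite T \<tau> = a"
    unfolding opposite_def
  proof (rule the_equality)
    fix v assume "v \<in> verts (simplex_of T \<tau>) \<and> v \<notin> \<tau>"
    then show "v = a" using a verts_mem by blast
  qed (use a in auto)
  with a show "opposite T \<tau> \<in> verts (simplex_of T \<tau>)" "opposite T \<tau> \<notin> \<tau>"
    "verts \<tau> = verts (simplex_of T \<tau>) - {opposite T \<tau>}" by auto
qed

lemma finite_verts: "\<sigma> \<in> simplices T \<Longrightarrow> finite (verts \<sigma>)"
  using simplex simplex_verts(1) by blast

lemma card_verts: "\<sigma> \<in> simplices T \<Longrightarrow> card (verts \<sigma>) = n + 1"
  using simplex_verts(4)[OF simplex] by (metis of_nat_1 of_nat_add of_nat_eq_iff)

lemma card_verts_facet: "\<tau> \<in> facets T \<Longrightarrow> card (verts \<tau>) = n"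
  using opposite[of \<tau>] card_verts[OF simplex_of_simplices] finite_verts[OF simplex_of_simplices]
  by simp

lemma facet_simplex: "\<tau> \<in> facets T \<Longrightarrow> (int n - 1) simplex \<tau>"
  using face_of_simplex_simplex[OF simplex[OF simplex_of_simplices] face_of_simplex_of]
    card_verts_facet by simp

lemma convex_facet: "\<tau> \<in> facets T \<Longrightarrow> convex \<tau>"
  using facet_simplex convex_simplex by blast

lemma convex_hull_verts_facet: "\<tau> \<in> facets T \<Longrightarrow> convex hull verts \<tau> = \<tau>"
  using facet_simplex simplex_verts(3) by blast

lemma facet_eqI:
  assumes "\<tau> \<in> facets T" "\<rho> \<in> facets T" "simplex_of T \<tau> = simplex_of T \<rho>" "opposite T \<tau> = opposite T \<rho>"
  shows "\<tau> = \<rho>"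
  using opposite(3)[OF assms(1)] opposite(3)[OF assms(2)] assms convex_hull_verts_facet by metis

section \<open>Face pairings as mutually inverse affine maps\<close>

lemma mate_facets: "\<tau> \<in> facets T \<Longrightarrow> mate T \<tau> \<in> facets T"
  and affine_pairing: "\<tau> \<in> facets T \<Longrightarrow> affine_map_on \<tau> (pairing T \<tau>)"
  and pairing_mate: "\<tau> \<in> facets T \<Longrightarrow> x \<in> \<tau> \<Longrightarrow> pairing T (mate T \<tau>) (pairing T \<tau> x) = x"
  using T by (auto simp: is_triangulation_def)

lemma mate_mate:
  assumes "\<tau> \<in> facets T"
  shows "mate T (mate T \<tau>) = \<tau>"
proof -
  have "mate T (mate T \<tau>) = pairing T (mate T \<tau>) ` pairing T \<tau> ` \<tau>"
    by (simp add: mate_def)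
  also have "\<dots> = (\<lambda>x. x) ` \<tau>"
    unfolding image_image using pairing_mate[OF assms] by (intro image_cong) auto
  finally show ?thesis by simp
qed

lemma pairing_mem_mate: "x \<in> \<tau> \<Longrightarrow> pairing T \<tau> x \<in> mate T \<tau>"
  by (simp add: mate_def)

lemma inj_on_pairing: "\<tau> \<in> facets T \<Longrightarrow> inj_on (pairing T \<tau>) \<tau>"
  using pairing_mate by (metis inj_on_inverseI)

lemma face_of_pairing_image: "\<tau> \<in> facets T \<Longrightarrow> e face_of \<tau> \<Longrightarrow> pairing T \<tau> ` e face_of mate T \<tau>"
  using face_of_affine_image affine_pairing inj_on_pairing convex_facet by (metis mate_def)

lemma pairing_mate_image:
  assumes "\<tau> \<in> facets T" "e \<subseteq> \<tau>"
  shows "pairing T (mate T \<tau>) ` pairing T \<tau> ` e = e"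
proof -
  have "pairing T (mate T \<tau>) ` pairing T \<tau> ` e = (\<lambda>x. x) ` e"
    unfolding image_image using pairing_mate[OF assms(1)] assms(2) by (intro image_cong) auto
  then show ?thesis by simp
qed

lemma verts_pairing_image:
  assumes "\<tau> \<in> facets T" "e face_of \<tau>"
  shows "verts (pairing T \<tau> ` e) = pairing T \<tau> ` verts e"
proof -
  \<comment> \<open>Proved for every facet because it is applied twice: to \<tau>, and to its mate
    in order to obtain the reverse inclusion.\<close>
  have sub: "pairing T \<rho> ` verts F \<subseteq> verts (pairing T \<rho> ` F)" if "\<rho> \<in> facets T" "F face_of \<rho>" for \<rho> F
  proof -
    have "{x} face_of \<rho>" if "x \<in> verts F" for x
    proof -
      have "{x} face_of F" using that by (simp add: verts_def face_of_singleton)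
      then show ?thesis using \<open>F face_of \<rho>\<close> face_of_trans by blast
    qed
    then have "{pairing T \<rho> x} face_of mate T \<rho>" if "x \<in> verts F" for x
      using face_of_pairing_image[OF \<open>\<rho> \<in> facets T\<close>, of "{x}"] that by simp
    moreover have "pairing T \<rho> ` F \<subseteq> mate T \<rho>"
      using face_of_pairing_image[OF that] face_of_imp_subset by blast
    ultimately have "{pairing T \<rho> x} face_of pairing T \<rho> ` F" if "x \<in> verts F" for x
      using face_of_subset[of "{pairing T \<rho> x}" "mate T \<rho>" "pairing T \<rho> ` F"] verts_mem[OF that] that
      by simp
    then show ?thesis by (auto simp: verts_def face_of_singleton)
  qed
  have e: "e \<subseteq> \<tau>" using assms(2) face_of_imp_subset by blast
  have "pairing T (mate T \<tau>) ` verts (pairing T \<tau> ` e) \<subseteq> verts e"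
    using sub[OF mate_facets[OF assms(1)] face_of_pairing_image[OF assms]]
      pairing_mate_image[OF assms(1) e] by simp
  then have "pairing T (mate T (mate T \<tau>)) ` pairing T (mate T \<tau>) ` verts (pairing T \<tau> ` e) \<subseteq> pairing T \<tau> ` verts e"
    using mate_mate[OF assms(1)] by (metis image_mono)
  moreover have "verts (pairing T \<tau> ` e) \<subseteq> mate T \<tau>"
    using e verts_mem by (fastforce simp: mate_def)
  ultimately have "verts (pairing T \<tau> ` e) \<subseteq> pairing T \<tau> ` verts e"
    using pairing_mate_image[OF mate_facets[OF assms(1)]] by metis
  with sub[OF assms] show ?thesis by blast
qed

lemma verts_mate: "\<tau> \<in> facets T \<Longrightarrow> verts (mate T \<tau>) = pairing T \<tau> ` verts \<tau>"
  using verts_pairing_image[of \<tau> \<tau>] by (simp add: mate_def face_of_refl convex_facet)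

lemma pairing_barycentre:
  assumes "\<tau> \<in> facets T" "e face_of \<tau>" "0 \<le> aff_dim e"
  shows "pairing T \<tau> (barycentre e) = barycentre (pairing T \<tau> ` e)"
proof -
  have e: "e \<subseteq> \<tau>" using assms(2) face_of_imp_subset by blast
  have "affine_map_on e (pairing T \<tau>)"
    using affine_pairing[OF assms(1)] e by (fastforce simp: affine_map_on_def)
  moreover have "aff_dim e simplex e"
    using face_of_simplex_simplex[OF facet_simplex[OF assms(1)] assms(2)]
      aff_dim_face_of_simplex[OF facet_simplex[OF assms(1)] assms(2)] by simp
  ultimately show ?thesis
    using barycentre_affine_image[of e "pairing T \<tau>"] verts_pairing_image[OF assms(1,2)]
      inj_on_subset[OF inj_on_pairing[OF assms(1)] e] assms(3) by simp
qed

section \<open>Perspectivities and projectivities as bijections of vertex sets\<close>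

lemma perspectivity_vertex:
  "\<tau> \<in> facets T \<Longrightarrow> w \<in> verts \<tau> \<Longrightarrow> perspectivity T \<tau> w = pairing T \<tau> w"
  using opposite(3)[of \<tau>] verts_mem[of w \<tau>] by (simp add: perspectivity_def)

lemma perspectivity_opposite:
  "\<tau> \<in> facets T \<Longrightarrow> perspectivity T \<tau> (opposite T \<tau>) = opposite T (mate T \<tau>)"
  using opposite[of \<tau>] by (simp add: perspectivity_def)

lemma verts_simplex_of:
  "\<tau> \<in> facets T \<Longrightarrow> verts (simplex_of T \<tau>) = insert (opposite T \<tau>) (verts \<tau>)"
  using opposite[of \<tau>] by auto

lemma perspectivity_mem:
  assumes "\<tau> \<in> facets T" "w \<in> verts (simplex_of T \<tau>)"
  shows "perspectivity T \<tau> w \<in> verts (simplex_of T (mate T \<tau>))"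
  using assms perspectivity_vertex perspectivity_opposite
  by (auto simp: verts_simplex_of mate_facets verts_mate)

lemma perspectivity_mate:
  assumes "\<tau> \<in> facets T" "w \<in> verts (simplex_of T \<tau>)"
  shows "perspectivity T (mate T \<tau>) (perspectivity T \<tau> w) = w"
  using assms perspectivity_vertex[of \<tau>] perspectivity_opposite[of \<tau>]
    perspectivity_vertex[of "mate T \<tau>"] perspectivity_opposite[of "mate T \<tau>"]
  by (auto simp: verts_simplex_of mate_facets verts_mate pairing_mate mate_mate verts_mem)

lemma perspectivity_bij:
  assumes "\<tau> \<in> facets T"
  shows "bij_betw (perspectivity T \<tau>) (verts (simplex_of T \<tau>)) (verts (simplex_of T (mate T \<tau>)))"
  using perspectivity_mem perspectivity_mate mate_facets mate_mate assms
  by (intro bij_betwI[where g = "perspectivity T (mate T \<tau>)"]) (metis Pi_I)+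

lemma dual_path_simplices:
  "dual_path T \<sigma> \<gamma> \<sigma>' \<Longrightarrow> \<sigma> \<in> simplices T \<Longrightarrow> \<sigma>' \<in> simplices T"
  by (induction \<gamma> arbitrary: \<sigma>) (auto simp: facetsI mate_facets simplex_of_simplices)

lemma projectivity_bij:
  "dual_path T \<sigma> \<gamma> \<sigma>' \<Longrightarrow> \<sigma> \<in> simplices T \<Longrightarrow> bij_betw (projectivity T \<sigma> \<gamma>) (verts \<sigma>) (verts \<sigma>')"
proof (induction \<gamma> arbitrary: \<sigma>)
  case Nil
  then show ?case by (auto simp: bij_betw_def inj_on_def)
next
  case (Cons \<tau> \<gamma>)
  then have \<tau>: "\<tau> \<in> facets T" "simplex_of T \<tau> = \<sigma>" by (auto simp: facetsI simplex_of_eq)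
  then have "bij_betw (perspectivity T \<tau>) (verts \<sigma>) (verts (simplex_of T (mate T \<tau>)))"
    using perspectivity_bij by blast
  moreover have "bij_betw (projectivity T (simplex_of T (mate T \<tau>)) \<gamma>) (verts (simplex_of T (mate T \<tau>))) (verts \<sigma>')"
    using Cons \<tau> by (auto simp: mate_facets simplex_of_simplices)
  ultimately show ?case by (auto intro: bij_betw_compose)
qed

text \<open>Concatenation runs through \<alpha> first, and composition applies its projectivity
  first. This is why the product in \<open>pi1\<close> reverses concatenation.\<close>

lemma projectivity_append:
  "dual_path T \<sigma> \<alpha> \<rho> \<Longrightarrow> \<sigma> \<in> simplices T \<Longrightarrow> w \<in> verts \<sigma> \<Longrightarrow>
     projectivity T \<sigma> (\<alpha> @ \<beta>) w = projectivity T \<rho> \<beta> (projectivity T \<sigma> \<alpha> w)"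
proof (induction \<alpha> arbitrary: \<sigma> w)
  case Nil
  then show ?case by simp
next
  case (Cons \<tau> \<alpha>)
  then have \<tau>: "\<tau> \<in> facets T" "simplex_of T \<tau> = \<sigma>" by (auto simp: facetsI simplex_of_eq)
  then have "perspectivity T \<tau> w \<in> verts (simplex_of T (mate T \<tau>))"
    using perspectivity_mem Cons.prems by blast
  then show ?case
    using Cons \<tau> by (simp add: compose_eq mate_facets simplex_of_simplices)
qed

lemma projectivity_mem:
  "dual_path T \<sigma> \<gamma> \<sigma>' \<Longrightarrow> \<sigma> \<in> simplices T \<Longrightarrow> w \<in> verts \<sigma> \<Longrightarrow> projectivity T \<sigma> \<gamma> w \<in> verts \<sigma>'"
  using projectivity_bij bij_betwE by blast

section \<open>Chains of gluings as dual paths\<close>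

lemma symp_glued: "symp (glued T)"
proof (rule sympI)
  fix x y assume "glued T x y"
  then obtain \<tau> where "\<tau> \<in> facets T" "x \<in> \<tau>" "y = pairing T \<tau> x"
    by (auto simp: glued_def)
  then show "glued T y x"
    unfolding glued_def by (intro bexI[of _ "mate T \<tau>"]) (auto simp: pairing_mate mate_facets pairing_mem_mate)
qed

text \<open>The mate undoes each pairing, so an equivalence is a chain of forward gluings only, and
  such a chain can be read directly as a path.\<close>

lemma equivclp_glued: "equivclp (glued T) = (glued T)\<^sup>*\<^sup>*"
  by (simp add: equivclp_def symp_symclp_eq symp_glued)

lemma quotient_proj_eq_iff: "quotient_proj T x = quotient_proj T y \<longleftrightarrow> (glued T)\<^sup>*\<^sup>* x y"
  unfolding quotient_proj_def equivclp_glued[symmetric]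
  using equivp_evquivclp[of "glued T"] by (auto simp: equivp_def)

text \<open>Invariant along the chain: the current point is a vertex of the current end simplex. The
  next facet contains this point, so by disjointness it belongs to that simplex and extends the
  path; the projectivity follows the point because a perspectivity agrees with the pairing on the
  facet.\<close>

lemma exists_dual_path_tracking:
  assumes "(glued T)\<^sup>*\<^sup>* v x" "\<sigma> \<in> simplices T" "v \<in> verts \<sigma>"
  shows "\<exists>\<gamma> \<sigma>'. dual_path T \<sigma> \<gamma> \<sigma>' \<and> x \<in> verts \<sigma>' \<and> projectivity T \<sigma> \<gamma> v = x"
  using assms(1)
proof induction
  case base
  then show ?case using assms by (intro exI[of _ "[]"]) auto
next
  case (step x y)
  then obtain \<gamma> \<sigma>' \<tau> where \<gamma>: "dual_path T \<sigma> \<gamma> \<sigma>'" "x \<in> verts \<sigma>'" "projectivity T \<sigma> \<gamma> v = x"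
    and \<tau>: "\<tau> \<in> facets T" "x \<in> \<tau>" "y = pairing T \<tau> x"
    by (auto simp: glued_def)
  have \<sigma>': "simplex_of T \<tau> = \<sigma>'" "\<tau> facet_of \<sigma>'"
    using simplex_of_eq_if_mem[OF \<tau>(1,2) dual_path_simplices[OF \<gamma>(1) assms(2)] verts_mem[OF \<gamma>(2)]]
      facet_of_simplex_of[OF \<tau>(1)] by auto
  have "perspectivity T \<tau> x = y"
    using \<gamma>(2) \<tau> \<sigma>' by (auto simp: perspectivity_def)
  moreover have "perspectivity T \<tau> x \<in> verts (simplex_of T (mate T \<tau>))"
    using perspectivity_mem \<tau> \<gamma> \<sigma>' by blast
  moreover have "dual_path T \<sigma> (\<gamma> @ [\<tau>]) (simplex_of T (mate T \<tau>))"
    using \<gamma> \<sigma>' by (auto simp: dual_path_append)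
  moreover have "projectivity T \<sigma> (\<gamma> @ [\<tau>]) v = perspectivity T \<tau> x"
    using projectivity_append[OF \<gamma>(1) assms(2,3), of "[\<tau>]"] \<gamma> calculation(2) by (simp add: compose_eq)
  ultimately show ?case by metis
qed

text \<open>The tracking path ends in a simplex with vertex \<open>v'\<close>. Since
  \<open>v'\<close> also lies in \<sigma>, disjointness closes the path.\<close>

lemma exists_dual_loop:
  assumes "\<sigma> \<in> simplices T" "v \<in> verts \<sigma>" "v' \<in> verts \<sigma>" "quotient_proj T v = quotient_proj T v'"
  shows "\<exists>\<gamma>\<in>dual_loops T \<sigma>. projectivity T \<sigma> \<gamma> v = v'"
proof -
  obtain \<gamma> \<sigma>' where \<gamma>: "dual_path T \<sigma> \<gamma> \<sigma>'" "v' \<in> verts \<sigma>'" "projectivity T \<sigma> \<gamma> v = v'"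
    using exists_dual_path_tracking assms quotient_proj_eq_iff by metis
  then have "\<sigma>' = \<sigma>"
    using assms dual_path_simplices simplices_eq verts_mem by metis
  with \<gamma> show ?thesis by (auto simp: dual_loops_def)
qed

section \<open>Dual curves as paths in the punctured space\<close>

lemma total_spaceI: "\<sigma> \<in> simplices T \<Longrightarrow> x \<in> \<sigma> \<Longrightarrow> x \<in> total_space T"
  by (auto simp: total_space_def)

lemma skeleton_0: "skeleton T 0 = quotient_proj T ` (\<Union>\<sigma>\<in>simplices T. verts \<sigma>)"
proof -
  have "\<Union>(ksimplices T 0) = (\<Union>\<sigma>\<in>simplices T. verts \<sigma>)"
    by (auto simp: ksimplices_def verts_def face_of_singleton aff_dim_eq_0)
       (metis face_of_singleton aff_dim_sing insertI1)
  then show ?thesis by (simp add: skeleton_def)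
qed

lemma finite_skeleton_0: "finite (skeleton T 0)"
  unfolding skeleton_0 using finite_simplices finite_verts by auto

text \<open>Needed so that a point that is no vertex cannot be glued to one and so stays off the
  0-skeleton.\<close>

lemma glued_verts:
  assumes "(glued T)\<^sup>*\<^sup>* x y" "\<sigma> \<in> simplices T" "x \<in> verts \<sigma>"
  shows "\<exists>\<sigma>'\<in>simplices T. y \<in> verts \<sigma>'"
  using exists_dual_path_tracking[OF assms] dual_path_simplices assms(2) by blast

lemma quotient_proj_notin_skeleton_0:
  assumes "\<sigma> \<in> simplices T" "x \<in> \<sigma>" "x \<notin> verts \<sigma>"
  shows "quotient_proj T x \<notin> skeleton T 0"
proof
  assume "quotient_proj T x \<in> skeleton T 0"
  then obtain \<sigma>' v where "\<sigma>' \<in> simplices T" "v \<in> verts \<sigma>'" "quotient_proj T v = quotient_proj T x"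
    by (auto simp: skeleton_0)
  then obtain \<sigma>'' where "\<sigma>'' \<in> simplices T" "x \<in> verts \<sigma>''"
    using glued_verts quotient_proj_eq_iff by metis
  then show False using assms simplices_eq verts_mem by metis
qed

lemma pathin_linepath:
  assumes "\<sigma> \<in> simplices T" "a \<in> \<sigma>" "b \<in> \<sigma>" "a \<notin> verts \<sigma>" "b \<notin> verts \<sigma>"
  shows "pathin (punctured_space T) (\<lambda>t. quotient_proj T (linepath a b t))"
proof -
  have mem: "linepath a b t \<in> \<sigma>" if "t \<in> {0..1}" for t
    using convexD_alt[OF convex_simplex[OF simplex[OF assms(1)]] assms(2,3)] that
    by (simp add: linepath_def)
  \<comment> \<open>A vertex is extreme, so it lies on a segment in \<sigma> only as an endpoint,
    and neither endpoint is a vertex.\<close>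
  have notv: "linepath a b t \<notin> verts \<sigma>" if "t \<in> {0..1}" for t
  proof
    assume v: "linepath a b t \<in> verts \<sigma>"
    have "linepath a b t \<in> closed_segment a b"
      using that linepath_image_01 by blast
    then show False using v assms by (auto simp: verts_def extreme_point_of_def closed_segment_eq_open)
  qed
  have "continuous_map (top_of_set {0..1}) (top_of_set (total_space T)) (linepath a b)"
    using mem total_spaceI[OF assms(1)]
    by (auto simp: continuous_map_in_subtopology image_subset_iff Pi_iff intro!: continuous_intros)
  then have "continuous_map (top_of_set {0..1}) (quotient_space T) (quotient_proj T \<circ> linepath a b)"
    using continuous_map_compose quotient_imp_continuous_map[OF quotient_map_quotient_proj] by blast
  then have "pathin (quotient_space T) (\<lambda>t. quotient_proj T (linepath a b t))"
    by (simp add: pathin_def o_def)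
  then show ?thesis
    using quotient_proj_notin_skeleton_0[OF assms(1)] mem notv total_spaceI[OF assms(1)]
    unfolding punctured_space_def pathin_subtopology topspace_quotient_space by auto
qed

lemma barycentre_simplex:
  assumes "\<sigma> \<in> simplices T"
  shows "barycentre \<sigma> \<in> \<sigma>" "barycentre \<sigma> \<notin> verts \<sigma>"
  using barycentre_mem[OF simplex[OF assms]] barycentre_not_vertex[OF simplex[OF assms]] n_ge_3 by auto

lemma barycentre_facet:
  assumes "\<tau> \<in> facets T"
  shows "barycentre \<tau> \<in> \<tau>" "barycentre \<tau> \<notin> verts (simplex_of T \<tau>)"
  using barycentre_mem[OF facet_simplex[OF assms]] barycentre_not_vertex[OF facet_simplex[OF assms]]
    n_ge_3 facet_subset[OF assms] by auto

lemma pathin_dual_edge: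
  assumes "\<tau> \<in> facets T"
  shows "pathin (punctured_space T) (dual_edge T \<tau>)"
    "dual_edge T \<tau> 0 = quotient_proj T (barycentre (simplex_of T \<tau>))"
    "dual_edge T \<tau> 1 = quotient_proj T (barycentre (simplex_of T (mate T \<tau>)))"
proof -
  \<comment> \<open>This makes the two halves of the edge meet: the barycentres of the facet and of
    its mate are the same point of the quotient.\<close>
  have bary: "pairing T \<tau> (barycentre \<tau>) = barycentre (mate T \<tau>)"
    using pairing_barycentre[OF assms, of \<tau>] aff_dim_simplex[OF facet_simplex[OF assms]] n_ge_3
    by (simp add: face_of_refl convex_facet[OF assms] mate_def)
  have "glued T (barycentre \<tau>) (barycentre (mate T \<tau>))"
    using assms barycentre_facet[OF assms] bary by (auto simp: glued_def)
  then have q: "quotient_proj T (barycentre \<tau>) = quotient_proj T (barycentre (mate T \<tau>))"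
    using quotient_proj_eq_iff by blast
  have "pathin (punctured_space T) (\<lambda>t. quotient_proj T (linepath (barycentre (simplex_of T \<tau>)) (barycentre \<tau>) t))"
    using assms barycentre_facet barycentre_simplex simplex_of_simplices facet_subset
    by (intro pathin_linepath[of "simplex_of T \<tau>"]) auto
  moreover have "pathin (punctured_space T) (\<lambda>t. quotient_proj T (linepath (barycentre (mate T \<tau>)) (barycentre (simplex_of T (mate T \<tau>))) t))"
    using mate_facets[OF assms] barycentre_facet barycentre_simplex simplex_of_simplices facet_subset
    by (intro pathin_linepath[of "simplex_of T (mate T \<tau>)"]) auto
  ultimately have "pathin (punctured_space T)
      (\<lambda>t. if t \<le> 1/2 then quotient_proj T (linepath (barycentre (simplex_of T \<tau>)) (barycentre \<tau>) (2 * t))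
        else quotient_proj T (linepath (barycentre (mate T \<tau>)) (barycentre (simplex_of T (mate T \<tau>))) (2 * t - 1)))"
    by (rule pathin_join) (simp add: linepath_def q)
  moreover have "dual_edge T \<tau> =
      (\<lambda>t. if t \<le> 1/2 then quotient_proj T (linepath (barycentre (simplex_of T \<tau>)) (barycentre \<tau>) (2 * t))
        else quotient_proj T (linepath (barycentre (mate T \<tau>)) (barycentre (simplex_of T (mate T \<tau>))) (2 * t - 1)))"
    by (simp add: dual_edge_def fun_eq_iff)
  ultimately show "pathin (punctured_space T) (dual_edge T \<tau>)" by simp
qed (simp_all add: dual_edge_def linepath_def)

lemma pathin_dual_curve:
  assumes "dual_path T \<sigma> \<gamma> \<sigma>'" "\<sigma> \<in> simplices T"
  shows "pathin (punctured_space T) (dual_curve T \<sigma> \<gamma>) \<and>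
    dual_curve T \<sigma> \<gamma> 0 = quotient_proj T (barycentre \<sigma>) \<and>
    dual_curve T \<sigma> \<gamma> 1 = quotient_proj T (barycentre \<sigma>')"
  using assms
proof (induction \<gamma> arbitrary: \<sigma>)
  case Nil
  have "pathin (punctured_space T) (\<lambda>t. quotient_proj T (linepath (barycentre \<sigma>) (barycentre \<sigma>) t))"
    using Nil barycentre_simplex by (intro pathin_linepath) auto
  moreover have "dual_curve T \<sigma> [] = (\<lambda>t. quotient_proj T (barycentre \<sigma>))" by auto
  ultimately show ?case using Nil by (simp add: linepath_refl)
next
  case (Cons \<tau> \<gamma>)
  then have \<tau>: "\<tau> \<in> facets T" "simplex_of T \<tau> = \<sigma>" by (auto simp: facetsI simplex_of_eq)
  let ?\<rho> = "simplex_of T (mate T \<tau>)"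
  have IH: "pathin (punctured_space T) (dual_curve T ?\<rho> \<gamma>)"
      "dual_curve T ?\<rho> \<gamma> 0 = quotient_proj T (barycentre ?\<rho>)"
      "dual_curve T ?\<rho> \<gamma> 1 = quotient_proj T (barycentre \<sigma>')"
    using Cons.IH[of ?\<rho>] Cons.prems \<tau> by (auto simp: mate_facets simplex_of_simplices)
  have "dual_curve T \<sigma> (\<tau> # \<gamma>) =
      (\<lambda>t. if t \<le> 1/2 then dual_edge T \<tau> (2 * t) else dual_curve T ?\<rho> \<gamma> (2 * t - 1))" by auto
  then have "pathin (punctured_space T) (dual_curve T \<sigma> (\<tau> # \<gamma>))"
    using pathin_join[OF pathin_dual_edge(1)[OF \<tau>(1)] IH(1)] pathin_dual_edge(3)[OF \<tau>(1)] IH(2) by simp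
  moreover have "dual_curve T \<sigma> (\<tau> # \<gamma>) 0 = quotient_proj T (barycentre \<sigma>)"
    "dual_curve T \<sigma> (\<tau> # \<gamma>) 1 = quotient_proj T (barycentre \<sigma>')"
    using pathin_dual_edge(2)[OF \<tau>(1)] \<tau>(2) IH(3) by simp_all
  ultimately show ?case by blast
qed

lemma loop_in_dual_curve:
  assumes "\<sigma> \<in> simplices T" "\<gamma> \<in> dual_loops T \<sigma>"
  shows "loop_in (punctured_space T) (quotient_proj T (barycentre \<sigma>)) (dual_curve T \<sigma> \<gamma>)"
  using pathin_dual_curve[of \<sigma> \<gamma> \<sigma>] assms by (auto simp: loop_in_def dual_loops_def)

end

section \<open>Turning around codimension-two faces\<close>

text \<open>The states of a turning walk. On them the definite description in
  \<open>other_facet\<close> has exactly one solution.\<close>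

definition flags :: "nat \<Rightarrow> 'a::euclidean_space triangulation \<Rightarrow> ('a set \<times> 'a set) set" where
  "flags n T = {(\<tau>, e). \<tau> \<in> facets T \<and> e face_of \<tau> \<and> aff_dim e = int n - 2}"

text \<open>\<open>flip\<close> stays inside a simplex and exchanges the two facets through the
  face; \<open>cross\<close> passes through the facet into the adjacent simplex. A turn is
  \<open>flip\<close> after \<open>cross\<close>, so \<open>cross\<close> after \<open>flip\<close>
  undoes it.\<close>

definition flip :: "'a::euclidean_space triangulation \<Rightarrow> 'a set \<times> 'a set \<Rightarrow> 'a set \<times> 'a set" where
  "flip T x = (other_facet T (fst x) (snd x), snd x)"

definition cross :: "'a::euclidean_space triangulation \<Rightarrow> 'a set \<times> 'a set \<Rightarrow> 'a set \<times> 'a set" where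
  "cross T x = (mate T (fst x), pairing T (fst x) ` snd x)"

lemma turn_eq: "turn T x = flip T (cross T x)"
  by (simp add: turn_def flip_def cross_def split_beta)

lemma snd_flip [simp]: "snd (flip T x) = snd x"
  by (simp add: flip_def)

lemma turn_walk_0: "turn_walk T \<tau> e 0 = []"
  by (simp add: turn_walk_def)

lemma turn_walk_Suc:
  "turn_walk T (fst x) (snd x) (Suc m) = fst x # turn_walk T (fst (turn T x)) (snd (turn T x)) m"
  by (simp add: turn_walk_def upt_conv_Cons funpow_swap1 del: upt_Suc flip: map_Suc_upt)

context triangulated
begin

section \<open>The two involutions on flags\<close>

lemma flag_facet: "x \<in> flags n T \<Longrightarrow> fst x \<in> facets T"
  and flag_face: "x \<in> flags n T \<Longrightarrow> snd x face_of fst x"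
  and flag_aff_dim: "x \<in> flags n T \<Longrightarrow> aff_dim (snd x) = int n - 2"
  by (auto simp: flags_def)

lemma flag_subset: "x \<in> flags n T \<Longrightarrow> snd x \<subseteq> fst x"
  using flag_face face_of_imp_subset by blast

lemma flag_face_simplex: "x \<in> flags n T \<Longrightarrow> snd x face_of simplex_of T (fst x)"
  using flag_facet flag_face face_of_simplex_of face_of_trans by blast

lemma card_verts_flag: "x \<in> flags n T \<Longrightarrow> card (verts (snd x)) = n - 1"
  using aff_dim_face_of_simplex[OF facet_simplex[OF flag_facet] flag_face, of x] flag_aff_dim[of x]
  by linarith

lemma flag_simplex: "x \<in> flags n T \<Longrightarrow> (int n - 2) simplex snd x"
  using face_of_simplex_simplex[OF facet_simplex[OF flag_facet] flag_face, of x]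
    aff_dim_face_of_simplex[OF facet_simplex[OF flag_facet] flag_face, of x] flag_aff_dim[of x]
  by simp

text \<open>The n - 1 vertices of the face and the corners opposite two distinct facets through it
  are n + 1 distinct vertices, hence all vertices of the simplex. The second facet is therefore
  determined by the one corner that remains.\<close>

lemma flipI:
  assumes x: "x \<in> flags n T" and \<rho>: "\<rho> \<in> facets T" "simplex_of T \<rho> = simplex_of T (fst x)"
    "snd x \<subseteq> \<rho>" "\<rho> \<noteq> fst x"
  shows "flip T x = (\<rho>, snd x)"
    "opposite T \<rho> \<noteq> opposite T (fst x)"
    "verts (simplex_of T (fst x)) = insert (opposite T (fst x)) (insert (opposite T \<rho>) (verts (snd x)))"
proof -
  let ?\<tau> = "fst x" and ?e = "snd x"
  let ?V = "verts (simplex_of T ?\<tau>)"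
  have *: "opposite T \<rho>' \<noteq> opposite T ?\<tau> \<and> ?V = insert (opposite T ?\<tau>) (insert (opposite T \<rho>') (verts ?e))"
    if \<rho>': "\<rho>' \<in> facets T" "simplex_of T \<rho>' = simplex_of T ?\<tau>" "?e \<subseteq> \<rho>'" "\<rho>' \<noteq> ?\<tau>" for \<rho>'
  proof
    show ne: "opposite T \<rho>' \<noteq> opposite T ?\<tau>"
      using facet_eqI that flag_facet[OF x] by blast
    have "opposite T \<rho>' \<notin> verts ?e" "opposite T ?\<tau> \<notin> verts ?e"
      using opposite(2)[OF \<rho>'(1)] opposite(2)[OF flag_facet[OF x]] \<rho>'(3) flag_subset[OF x]
        verts_mem by blast+
    moreover have fin: "finite (verts ?e)" using simplex_verts(1)[OF flag_simplex[OF x]] .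
    ultimately have "card (insert (opposite T ?\<tau>) (insert (opposite T \<rho>') (verts ?e))) = card ?V"
      using ne card_verts_flag[OF x] n_ge_3 card_verts[OF simplex_of_simplices[OF flag_facet[OF x]]] by simp
    moreover have "insert (opposite T ?\<tau>) (insert (opposite T \<rho>') (verts ?e)) \<subseteq> ?V"
      using opposite(1)[OF \<rho>'(1)] opposite(1)[OF flag_facet[OF x]] \<rho>'(2)
        verts_face_subset[OF simplex[OF simplex_of_simplices[OF flag_facet[OF x]]] flag_face_simplex[OF x]]
      by auto
    ultimately show "?V = insert (opposite T ?\<tau>) (insert (opposite T \<rho>') (verts ?e))"
      using card_subset_eq finite_verts[OF simplex_of_simplices[OF flag_facet[OF x]]] by metis
  qed
  show "opposite T \<rho> \<noteq> opposite T (fst x)"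
    "verts (simplex_of T (fst x)) = insert (opposite T (fst x)) (insert (opposite T \<rho>) (verts (snd x)))"
    using *[OF \<rho>] by auto
  have "other_facet T ?\<tau> ?e = \<rho>"
    unfolding other_facet_def
  proof (rule the_equality)
    show "\<rho> facet_of simplex_of T ?\<tau> \<and> ?e \<subseteq> \<rho> \<and> \<rho> \<noteq> ?\<tau>"
      using \<rho> facet_of_simplex_of by metis
    fix \<rho>' assume \<rho>': "\<rho>' facet_of simplex_of T ?\<tau> \<and> ?e \<subseteq> \<rho>' \<and> \<rho>' \<noteq> ?\<tau>"
    then have f: "\<rho>' \<in> facets T" "simplex_of T \<rho>' = simplex_of T ?\<tau>"
      using facetsI simplex_of_eq simplex_of_simplices[OF flag_facet[OF x]] by blast+
    have "opposite T \<rho>' \<in> ?V" "opposite T \<rho>' \<noteq> opposite T ?\<tau>" "opposite T \<rho>' \<notin> verts ?e"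
      using *[of \<rho>'] f \<rho>' opposite(2)[OF f(1)] verts_mem[of "opposite T \<rho>'" "snd x"] by blast+
    then have "opposite T \<rho>' = opposite T \<rho>"
      using *[OF \<rho>] by blast
    then show "\<rho>' = \<rho>" using facet_eqI f \<rho> by simp
  qed
  then show "flip T x = (\<rho>, snd x)" by (simp add: flip_def)
qed

text \<open>The facet has a vertex \<open>b\<close> off the face. The facet opposite
  \<open>b\<close> still contains the face, but not \<open>b\<close>.\<close>

lemma exists_flip:
  assumes x: "x \<in> flags n T"
  shows "\<exists>\<rho>\<in>facets T. simplex_of T \<rho> = simplex_of T (fst x) \<and> snd x \<subseteq> \<rho> \<and> \<rho> \<noteq> fst x"
proof -
  let ?\<sigma> = "simplex_of T (fst x)"
  have \<sigma>: "?\<sigma> \<in> simplices T" "int n simplex ?\<sigma>"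
    using simplex_of_simplices[OF flag_facet[OF x]] simplex by auto
  have "verts (snd x) \<subset> verts (fst x)"
    using verts_face_subset[OF facet_simplex[OF flag_facet[OF x]] flag_face[OF x]]
      card_verts_flag[OF x] card_verts_facet[OF flag_facet[OF x]] n_ge_3 by force
  then obtain b where b: "b \<in> verts (fst x)" "b \<notin> verts (snd x)" by blast
  then have b\<sigma>: "b \<in> verts ?\<sigma>" using opposite(3)[OF flag_facet[OF x]] by auto
  let ?\<rho> = "convex hull (verts ?\<sigma> - {b})"
  have \<rho>: "?\<rho> facet_of ?\<sigma>" "verts ?\<rho> = verts ?\<sigma> - {b}"
    using convex_hull_facet_of_simplex[OF \<sigma>(2) _ b\<sigma>] n_ge_3
      verts_convex_hull_subset[OF \<sigma>(2), of "verts ?\<sigma> - {b}"] by auto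
  have "snd x \<subseteq> ?\<rho>"
    using face_of_simplex_subset_iff[OF \<sigma>(2) flag_face_simplex[OF x] facet_of_imp_face_of[OF \<rho>(1)]]
      verts_face_subset[OF \<sigma>(2) flag_face_simplex[OF x]] b \<rho>(2) by auto
  moreover have "?\<rho> \<noteq> fst x" using b \<rho>(2) by auto
  ultimately show ?thesis
    using facetsI[OF \<sigma>(1) \<rho>(1)] simplex_of_eq[OF \<sigma>(1) \<rho>(1)] by blast
qed

lemma flip:
  assumes x: "x \<in> flags n T"
  shows "flip T x \<in> flags n T" "flip T (flip T x) = x" "flip T x \<noteq> x"
    "simplex_of T (fst (flip T x)) = simplex_of T (fst x)"
    "opposite T (fst (flip T x)) \<noteq> opposite T (fst x)"
    "verts (simplex_of T (fst x)) =
      insert (opposite T (fst x)) (insert (opposite T (fst (flip T x))) (verts (snd x)))"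
proof -
  obtain \<rho> where \<rho>: "\<rho> \<in> facets T" "simplex_of T \<rho> = simplex_of T (fst x)" "snd x \<subseteq> \<rho>" "\<rho> \<noteq> fst x"
    using exists_flip[OF x] by blast
  have flip: "flip T x = (\<rho>, snd x)" using flipI(1)[OF x \<rho>] .
  have "\<rho> \<subseteq> simplex_of T (fst x)" using \<rho> facet_subset by auto
  then have "snd x face_of \<rho>"
    using face_of_subset[OF flag_face_simplex[OF x] \<rho>(3)] by blast
  then show fl: "flip T x \<in> flags n T"
    using \<rho> flag_aff_dim[OF x] flip by (simp add: flags_def)
  show "flip T (flip T x) = x"
    using flipI(1)[OF fl, of "fst x"] flip \<rho> flag_facet[OF x] flag_subset[OF x] by simp
  show "flip T x \<noteq> x" using flip \<rho>(4) by (metis fst_conv)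
  show "simplex_of T (fst (flip T x)) = simplex_of T (fst x)"
    "opposite T (fst (flip T x)) \<noteq> opposite T (fst x)"
    "verts (simplex_of T (fst x)) =
      insert (opposite T (fst x)) (insert (opposite T (fst (flip T x))) (verts (snd x)))"
    using flip \<rho> flipI(2,3)[OF x \<rho>] by auto
qed

lemma cross:
  assumes x: "x \<in> flags n T"
  shows "cross T x \<in> flags n T" "cross T (cross T x) = x"
proof -
  let ?\<tau> = "fst x" and ?e = "snd x"
  have \<tau>: "?\<tau> \<in> facets T" "?e face_of ?\<tau>" "?e \<subseteq> ?\<tau>"
    using x flag_facet flag_face flag_subset by auto
  have f: "pairing T ?\<tau> ` ?e face_of mate T ?\<tau>" using face_of_pairing_image[OF \<tau>(1,2)] .
  have "inj_on (pairing T ?\<tau>) (verts ?e)"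
    using inj_on_subset[OF inj_on_pairing[OF \<tau>(1)]] \<tau>(3) verts_mem by blast
  then have "card (verts (pairing T ?\<tau> ` ?e)) = n - 1"
    using card_verts_flag[OF x] verts_pairing_image[OF \<tau>(1,2)] by (simp add: card_image)
  then have "aff_dim (pairing T ?\<tau> ` ?e) = int n - 2"
    using aff_dim_face_of_simplex[OF facet_simplex[OF mate_facets[OF \<tau>(1)]] f] n_ge_3 by simp
  then show "cross T x \<in> flags n T"
    using f mate_facets[OF \<tau>(1)] by (simp add: flags_def cross_def)
  show "cross T (cross T x) = x"
    using mate_mate[OF \<tau>(1)] pairing_mate_image[OF \<tau>(1,3)] by (simp add: cross_def)
qed

section \<open>Iterated turning and its effect on vertices\<close>

lemma turn_flags: "x \<in> flags n T \<Longrightarrow> turn T x \<in> flags n T"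
  by (simp add: turn_eq flip cross)

lemma funpow_turn_flags: "x \<in> flags n T \<Longrightarrow> (turn T ^^ k) x \<in> flags n T"
  by (induction k) (auto simp: turn_flags)

lemma cross_flip_turn: "x \<in> flags n T \<Longrightarrow> cross T (flip T (turn T x)) = x"
  by (simp add: turn_eq flip cross)

lemma flip_turn: "x \<in> flags n T \<Longrightarrow> flip T (turn T x) = cross T x"
  by (simp add: turn_eq flip cross)

lemma simplex_of_turn: "x \<in> flags n T \<Longrightarrow> simplex_of T (fst (turn T x)) = simplex_of T (mate T (fst x))"
  using flip(4)[OF cross(1)] by (simp add: turn_eq cross_def)

text \<open>One crossing exchanges the roles of the two corners off the face: the corner opposite
  the facet being crossed goes to the corner opposite the facet of entry, and the other one goes to
  the corner opposite the facet to be crossed next.\<close>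

lemma perspectivity_turn:
  assumes x: "x \<in> flags n T"
  shows "perspectivity T (fst x) (opposite T (fst x)) = opposite T (fst (flip T (turn T x)))"
    and "perspectivity T (fst x) (opposite T (fst (flip T x))) = opposite T (fst (turn T x))"
    and "w \<in> verts (snd x) \<Longrightarrow> perspectivity T (fst x) w = pairing T (fst x) w"
    and "w \<in> verts (snd x) \<Longrightarrow> pairing T (fst x) w \<in> verts (snd (turn T x))"
proof -
  let ?\<tau> = "fst x" and ?e = "snd x"
  have \<tau>: "?\<tau> \<in> facets T" "?e face_of ?\<tau>" "?e \<subseteq> ?\<tau>"
    using x flag_facet flag_face flag_subset by auto
  have ve: "verts ?e \<subseteq> verts ?\<tau>"
    using verts_face_subset[OF facet_simplex[OF \<tau>(1)] \<tau>(2)] .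
  show "perspectivity T (fst x) (opposite T (fst x)) = opposite T (fst (flip T (turn T x)))"
    using perspectivity_opposite[OF \<tau>(1)] flip_turn[OF x] by (simp add: cross_def)
  show "perspectivity T (fst x) w = pairing T (fst x) w" if "w \<in> verts ?e"
    using that ve perspectivity_vertex[OF \<tau>(1)] by blast
  show "pairing T (fst x) w \<in> verts (snd (turn T x))" if "w \<in> verts ?e"
    using that verts_pairing_image[OF \<tau>(1,2)] by (simp add: turn_eq cross_def)
  \<comment> \<open>This corner is a vertex of the facet but not of the face. Its image under the
    injective pairing is neither on the image face nor opposite the mate, so only one corner of the
    next simplex is left.\<close>
  let ?b = "opposite T (fst (flip T x))"
  have b: "?b \<in> verts ?\<tau>" "?b \<notin> verts ?e"
    using flip(4,5)[OF x] opposite(1,2)[OF flag_facet[OF flip(1)[OF x]]] opposite(3)[OF \<tau>(1)]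
      flag_subset[OF flip(1)[OF x]] verts_mem[of ?b ?e] by auto
  have p: "pairing T ?\<tau> ?b \<in> verts (mate T ?\<tau>)"
    using verts_mate[OF \<tau>(1)] b by auto
  have "pairing T ?\<tau> ?b \<notin> verts (pairing T ?\<tau> ` ?e)"
    unfolding verts_pairing_image[OF \<tau>(1,2)]
    using inj_on_pairing[OF \<tau>(1)] b ve verts_mem[of _ ?\<tau>] by (auto dest!: inj_onD)
  moreover have "pairing T ?\<tau> ?b \<noteq> opposite T (mate T ?\<tau>)"
    using opposite(3)[OF mate_facets[OF \<tau>(1)]] p by auto
  moreover have "pairing T ?\<tau> ?b \<in> verts (simplex_of T (mate T ?\<tau>))"
    using opposite(3)[OF mate_facets[OF \<tau>(1)]] p by auto
  ultimately have "pairing T ?\<tau> ?b = opposite T (fst (flip T (cross T x)))"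
    using flip(6)[OF cross(1)[OF x]] by (simp add: cross_def)
  then show "perspectivity T (fst x) ?b = opposite T (fst (turn T x))"
    using perspectivity_vertex[OF \<tau>(1) b(1)] by (simp add: turn_eq)
qed

lemma dual_path_turn_walk:
  "x \<in> flags n T \<Longrightarrow>
    dual_path T (simplex_of T (fst x)) (turn_walk T (fst x) (snd x) m) (simplex_of T (fst ((turn T ^^ m) x)))"
proof (induction m arbitrary: x)
  case (Suc m)
  then show ?case
    using Suc.IH[OF turn_flags[OF Suc.prems]] facet_of_simplex_of[OF flag_facet[OF Suc.prems]]
    by (simp add: turn_walk_Suc simplex_of_turn funpow_swap1)
qed (simp add: turn_walk_0)

text \<open>Vertices of the face are moved by the pairings alone. The other two corners exchange
  roles once per step, so their final positions depend on the parity of \<open>m\<close>.\<close>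

lemma projectivity_turn_walk:
  assumes "x \<in> flags n T"
  shows "w \<in> verts (snd x) \<Longrightarrow>
      projectivity T (simplex_of T (fst x)) (turn_walk T (fst x) (snd x) m) w
        = fold (pairing T) (turn_walk T (fst x) (snd x) m) w"
    and "projectivity T (simplex_of T (fst x)) (turn_walk T (fst x) (snd x) m) (opposite T (fst x))
        = (let y = (turn T ^^ m) x in opposite T (fst (if even m then y else flip T y)))"
    and "projectivity T (simplex_of T (fst x)) (turn_walk T (fst x) (snd x) m) (opposite T (fst (flip T x)))
        = (let y = (turn T ^^ m) x in opposite T (fst (if even m then flip T y else y)))"
proof -
  have v: "opposite T (fst x) \<in> verts (simplex_of T (fst x))"
    "opposite T (fst (flip T x)) \<in> verts (simplex_of T (fst x))"
    "w \<in> verts (snd x) \<Longrightarrow> w \<in> verts (simplex_of T (fst x))" if "x \<in> flags n T" for x w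
    using flip(6)[OF that] by auto
  show "w \<in> verts (snd x) \<Longrightarrow>
      projectivity T (simplex_of T (fst x)) (turn_walk T (fst x) (snd x) m) w
        = fold (pairing T) (turn_walk T (fst x) (snd x) m) w"
    using assms
  proof (induction m arbitrary: x w)
    case (Suc m)
    show ?case
      using Suc.IH[OF perspectivity_turn(4)[OF Suc.prems(2,1)] turn_flags[OF Suc.prems(2)]]
        perspectivity_turn(3)[OF Suc.prems(2,1)] v(3)[OF Suc.prems(2,1)]
      by (simp add: turn_walk_Suc compose_eq simplex_of_turn[OF Suc.prems(2)])
  qed (simp add: turn_walk_0 v)
  \<comment> \<open>One induction for both corners, because each step turns one claim into the
    other.\<close>
  have "projectivity T (simplex_of T (fst x)) (turn_walk T (fst x) (snd x) m) (opposite T (fst x))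
        = (let y = (turn T ^^ m) x in opposite T (fst (if even m then y else flip T y))) \<and>
      projectivity T (simplex_of T (fst x)) (turn_walk T (fst x) (snd x) m) (opposite T (fst (flip T x)))
        = (let y = (turn T ^^ m) x in opposite T (fst (if even m then flip T y else y)))"
    using assms
  proof (induction m arbitrary: x)
    case (Suc m)
    show ?case
      using Suc.IH[OF turn_flags[OF Suc.prems]]
        perspectivity_turn(1,2)[OF Suc.prems] v(1,2)[OF Suc.prems]
      by (simp add: turn_walk_Suc compose_eq simplex_of_turn[OF Suc.prems] Let_def funpow_swap1)
  qed (simp add: turn_walk_0 v)
  then show "projectivity T (simplex_of T (fst x)) (turn_walk T (fst x) (snd x) m) (opposite T (fst x))
        = (let y = (turn T ^^ m) x in opposite T (fst (if even m then y else flip T y)))"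
    "projectivity T (simplex_of T (fst x)) (turn_walk T (fst x) (snd x) m) (opposite T (fst (flip T x)))
        = (let y = (turn T ^^ m) x in opposite T (fst (if even m then flip T y else y)))"
    by auto
qed

text \<open>A facet containing the barycentre of an (n-2)-face contains the face, hence is one of
  the two facets of that simplex through it. Gluing along one of them is a turn, along the other an
  inverse turn, so a set of flags closed under both accounts for every point glued to the
  barycentre.\<close>

lemma orbit_chase:
  assumes X: "X \<subseteq> flags n T" "\<And>x. x \<in> X \<Longrightarrow> turn T x \<in> X" "\<And>x. x \<in> X \<Longrightarrow> cross T (flip T x) \<in> X"
    and "x \<in> X" "(glued T)\<^sup>*\<^sup>* (barycentre (snd x)) y"
  shows "\<exists>z\<in>X. y = barycentre (snd z)"
  using assms(5)
proof induction
  case base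
  then show ?case using assms(4) by blast
next
  case (step y y')
  then obtain z \<tau> where z: "z \<in> X" "y = barycentre (snd z)"
    and \<tau>: "\<tau> \<in> facets T" "y \<in> \<tau>" "y' = pairing T \<tau> y"
    by (auto simp: glued_def)
  have zf: "z \<in> flags n T" using z X by blast
  have dim: "0 \<le> int n - 2" using n_ge_3 by simp
  have "y \<in> simplex_of T (fst z)"
    using barycentre_mem[OF flag_simplex[OF zf] dim] flag_subset[OF zf] facet_subset[OF flag_facet[OF zf]] z
    by auto
  then have s: "simplex_of T \<tau> = simplex_of T (fst z)"
    using simplex_of_eq_if_mem[OF \<tau>(1,2) simplex_of_simplices[OF flag_facet[OF zf]]] by blast
  have sub: "snd z \<subseteq> \<tau>"
    using face_subset_if_barycentre_mem[OF flag_simplex[OF zf] dim, of "simplex_of T \<tau>" \<tau>]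
      flag_face_simplex[OF zf] face_of_imp_subset face_of_simplex_of[OF \<tau>(1)] s \<tau>(2) z(2) by auto
  have "snd z face_of \<tau>"
    using face_of_subset[OF flag_face_simplex[OF zf] sub] face_of_simplex_of[OF \<tau>(1)] s face_of_imp_subset
    by metis
  then have y': "y' = barycentre (pairing T \<tau> ` snd z)"
    using pairing_barycentre[OF \<tau>(1)] \<tau>(3) z(2) flag_aff_dim[OF zf] dim by simp
  show ?case
  proof (cases "\<tau> = fst z")
    case True
    then show ?thesis
      using y' X(2)[OF z(1)] by (auto simp: turn_eq cross_def intro!: bexI[of _ "turn T z"])
  next
    case False
    then have "flip T z = (\<tau>, snd z)" using flipI(1)[OF zf \<tau>(1) s sub] by blast
    then show ?thesis
      using y' X(3)[OF z(1)] by (auto simp: cross_def intro!: bexI[of _ "cross T (flip T z)"])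
  qed
qed

lemma quotient_proj_cross:
  assumes "x \<in> flags n T"
  shows "quotient_proj T ` snd (cross T x) = quotient_proj T ` snd x"
proof -
  have "quotient_proj T (pairing T (fst x) p) = quotient_proj T p" if "p \<in> snd x" for p
  proof -
    have "glued T p (pairing T (fst x) p)"
      using that flag_subset[OF assms] flag_facet[OF assms] by (auto simp: glued_def)
    then show ?thesis using quotient_proj_eq_iff r_into_rtranclp by metis
  qed
  then show ?thesis unfolding cross_def snd_conv image_image by (intro image_cong) auto
qed

lemma flag_ksimplices: "x \<in> flags n T \<Longrightarrow> snd x \<in> ksimplices T (n - 2)"
  using flag_face_simplex[of x] simplex_of_simplices[OF flag_facet, of x] flag_aff_dim[of x] n_ge_3
  by (auto simp: ksimplices_def of_nat_diff)

text \<open>Equality of images provides a point of \<open>F\<close> glued to the barycentre of the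
  given face. By \<open>orbit_chase\<close> it is the barycentre of a face from \<open>X\<close>;
  that face lies in \<open>F\<close> and has the same dimension, so it equals
  \<open>F\<close>.\<close>

lemma singlex_eq_orbit:
  assumes X: "X \<subseteq> flags n T" "\<And>x. x \<in> X \<Longrightarrow> turn T x \<in> X" "\<And>x. x \<in> X \<Longrightarrow> cross T (flip T x) \<in> X"
    and "x \<in> X" and proj: "\<And>z. z \<in> X \<Longrightarrow> quotient_proj T ` snd z = quotient_proj T ` snd x"
  shows "{F \<in> ksimplices T (n - 2). quotient_proj T ` F = quotient_proj T ` snd x} = snd ` X"
proof (intro equalityI subsetI)
  fix F assume "F \<in> snd ` X"
  then show "F \<in> {F \<in> ksimplices T (n - 2). quotient_proj T ` F = quotient_proj T ` snd x}"
    using flag_ksimplices X(1) proj by blast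
next
  fix F assume F: "F \<in> {F \<in> ksimplices T (n - 2). quotient_proj T ` F = quotient_proj T ` snd x}"
  then obtain \<sigma> where \<sigma>: "\<sigma> \<in> simplices T" "F face_of \<sigma>" "aff_dim F = int n - 2"
    using n_ge_3 by (auto simp: ksimplices_def)
  have dim: "0 \<le> int n - 2" using n_ge_3 by simp
  have xf: "x \<in> flags n T" using X assms(4) by blast
  have "quotient_proj T (barycentre (snd x)) \<in> quotient_proj T ` F"
    using F barycentre_mem[OF flag_simplex[OF xf] dim] by auto
  then obtain y where y: "y \<in> F" "quotient_proj T (barycentre (snd x)) = quotient_proj T y"
    by blast
  then obtain z where z: "z \<in> X" "y = barycentre (snd z)"
    using orbit_chase[OF X assms(4)] quotient_proj_eq_iff by blast
  have zf: "z \<in> flags n T" using z X by blast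
  have "y \<in> simplex_of T (fst z)"
    using barycentre_mem[OF flag_simplex[OF zf] dim] flag_subset[OF zf] facet_subset[OF flag_facet[OF zf]] z
    by auto
  moreover have "y \<in> \<sigma>" using y(1) \<sigma>(2) face_of_imp_subset by blast
  ultimately have s: "simplex_of T (fst z) = \<sigma>"
    using simplices_eq \<sigma>(1) simplex_of_simplices[OF flag_facet[OF zf]] by blast
  have zs: "snd z face_of \<sigma>" using flag_face_simplex[OF zf] s by simp
  have sub: "snd z \<subseteq> F"
    using face_subset_if_barycentre_mem[OF flag_simplex[OF zf] dim face_of_imp_subset[OF zs] \<sigma>(2)] y z by simp
  have "snd z face_of F"
    using face_of_subset[OF zs sub face_of_imp_subset[OF \<sigma>(2)]] .
  then have "snd z = F"
    using face_of_aff_dim_lt[of F "snd z"] flag_aff_dim[OF zf] \<sigma>(3)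
      face_of_imp_convex[OF \<sigma>(2)] by force
  then show "F \<in> snd ` X" using z by blast
qed

text \<open>
  The turning orbit \<open>X\<close> of a flag either is stable under \<^const>\<open>flip\<close>, a fixed-point-free
  involution, or contains exactly one flag for each face in the gluing class of the codimension-two
  face, so that its size is the degree.  The first case can occur when a facet is paired with itself.
\<close>

lemma even_turn_period:
  assumes ev: "even_triangulation n T" and x: "x \<in> flags n T" and m: "0 < m" "(turn T ^^ m) x = x"
  shows "even m"
proof -
  define X where "X = range (\<lambda>k. (turn T ^^ k) x)"
  have Xf: "X \<subseteq> flags n T" using funpow_turn_flags[OF x] by (auto simp: X_def)
  have xX: "x \<in> X" unfolding X_def by (rule range_eqI[of _ _ 0]) simp
  have turnX: "turn T z \<in> X" if z: "z \<in> X" for z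
  proof -
    obtain k where "z = (turn T ^^ k) x" using z unfolding X_def by blast
    then show ?thesis unfolding X_def by (intro range_eqI[of _ _ "Suc k"]) simp
  qed
  \<comment> \<open>Periodicity makes the inverse turn a forward power of \<open>turn\<close>;
    adding \<open>m\<close> to the exponent keeps it a natural number after subtracting 1, also for
    \<open>k = 0\<close>.\<close>
  have unturnX: "cross T (flip T z) \<in> X" if z: "z \<in> X" for z
  proof -
    obtain k where k: "z = (turn T ^^ k) x" using z unfolding X_def by blast
    have "z = (turn T ^^ (k + m)) x" using k m by (simp add: funpow_add)
    also have "\<dots> = turn T ((turn T ^^ (k + m - 1)) x)"
      using m(1) by (cases "k + m") auto
    finally have "cross T (flip T z) = (turn T ^^ (k + m - 1)) x"
      using cross_flip_turn[OF funpow_turn_flags[OF x]] by simp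
    then show ?thesis unfolding X_def by blast
  qed
  \<comment> \<open>A flag can return before its face returns pointwise, so \<open>m\<close> need
    not be the smallest period. The smallest period \<open>r\<close> is the size of \<open>X\<close>
    and divides \<open>m\<close>.\<close>
  define r where "r = (LEAST r. 0 < r \<and> (turn T ^^ r) x = x)"
  have r: "0 < r" "(turn T ^^ r) x = x"
    using LeastI[of "\<lambda>r. 0 < r \<and> (turn T ^^ r) x = x" m] m by (auto simp: r_def)
  have least: "(turn T ^^ k) x \<noteq> x" if "0 < k" "k < r" for k
    using not_less_Least[of k "\<lambda>r. 0 < r \<and> (turn T ^^ r) x = x"] that by (auto simp: r_def)
  have "X = (\<lambda>k. (turn T ^^ k) x) ` {0..<r}"
  proof
    show "X \<subseteq> (\<lambda>k. (turn T ^^ k) x) ` {0..<r}"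
      unfolding X_def using funpow_mod_eq[OF r(2)] r(1)
      by (metis (no_types, lifting) atLeastLessThan_iff image_eqI image_subsetI mod_less_divisor zero_le)
  qed (auto simp: X_def)
  then have finX: "finite X" and cardX: "card X = r"
    using card_image[OF inj_on_funpow_least[OF r(2) least]] by auto
  have "(turn T ^^ (m mod r)) x = x"
    using funpow_mod_eq[OF r(2), of m] m(2) by simp
  then have "r dvd m"
    using least[of "m mod r"] r(1) by (auto simp: mod_eq_0_iff_dvd[symmetric])
  moreover have "even (card X)"
  proof (cases "\<exists>z\<in>X. flip T z \<in> X")
    case True
    then obtain i where i: "flip T ((turn T ^^ i) x) \<in> X" unfolding X_def by blast
    \<comment> \<open>Dihedral relation: it carries membership of a flip in \<open>X\<close>
      backwards from the i-th flag to \<open>x\<close>. From there it is propagated forwards along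
      the whole orbit.\<close>
    have flip_eq: "flip T z = turn T (flip T (turn T z))" if "z \<in> flags n T" for z
      using flip_turn[OF that] cross(2)[OF that] by (simp add: turn_eq)
    have "flip T x \<in> X"
      using i
    proof (induction i)
      case (Suc i)
      then show ?case
        using flip_eq[OF funpow_turn_flags[OF x, of i]] turnX by simp
    qed simp
    have "flip T ((turn T ^^ k) x) \<in> X" for k
    proof (induction k)
      case (Suc k)
      have "flip T (turn T ((turn T ^^ k) x)) = cross T (flip T (flip T ((turn T ^^ k) x)))"
        using flip_turn flip(2) funpow_turn_flags[OF x] by simp
      then show ?case using unturnX[OF Suc] by simp
    qed (use \<open>flip T x \<in> X\<close> in simp)
    then have "flip T z \<in> X" if "z \<in> X" for z
      using that unfolding X_def by blast
    then show ?thesis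
      using finX flip(2,3) Xf by (intro even_card_involution[of X "flip T"]) auto
  next
    case False
    \<comment> \<open>Two flags on the same face lie in one simplex, since both facets contain the
      barycentre of the face. If distinct, they are flips of each other, which this case
      excludes.\<close>
    have inj: "inj_on snd X"
    proof (rule inj_onI, rule ccontr)
      fix y z assume yz: "y \<in> X" "z \<in> X" "snd y = snd z" "y \<noteq> z"
      have yzf: "y \<in> flags n T" "z \<in> flags n T" using yz Xf by auto
      have dim: "0 \<le> int n - 2" using n_ge_3 by simp
      have b: "barycentre (snd z) \<in> fst y" "barycentre (snd z) \<in> fst z"
        using barycentre_mem[OF flag_simplex dim] flag_subset yzf yz(3) by (metis subsetD)+
      have "simplex_of T (fst z) = simplex_of T (fst y)"
        using simplex_of_eq_if_mem[OF flag_facet[OF yzf(2)] b(2) simplex_of_simplices[OF flag_facet[OF yzf(1)]]]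
          facet_subset[OF flag_facet[OF yzf(1)] b(1)] by blast
      then have "flip T y = (fst z, snd y)"
        using flipI(1)[OF yzf(1) flag_facet[OF yzf(2)]] flag_subset[OF yzf(2)] yz(3,4)
        by (metis prod_eqI)
      then show False using False yz by (metis prod.collapse)
    qed
    have "quotient_proj T ` snd ((turn T ^^ k) x) = quotient_proj T ` snd x" for k
    proof (induction k)
      case (Suc k)
      then show ?case
        using quotient_proj_cross[OF funpow_turn_flags[OF x, of k]]
        turn_eq[of T "(turn T ^^ k) x"] by simp
    qed simp
    then have proj: "quotient_proj T ` snd z = quotient_proj T ` snd x" if "z \<in> X" for z
      using that unfolding X_def by blast
    have "{F \<in> ksimplices T (n - 2). quotient_proj T ` F = quotient_proj T ` snd x} = snd ` X"
      by (rule singlex_eq_orbit[OF Xf _ _ xX]) (fact turnX unturnX proj)+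
    then have "singlex_degree T (n - 2) (quotient_proj T ` snd x) = card (snd ` X)"
      by (simp add: singlex_degree_def)
    moreover have "quotient_proj T ` snd x \<in> singlexes T (n - 2)"
      using flag_ksimplices[OF x] by (auto simp: singlexes_def)
    ultimately show ?thesis
      using ev card_image[OF inj] by (metis even_triangulation_def)
  qed
  ultimately show ?thesis using cardX dvd_trans by blast
qed

text \<open>After an even number of steps the two corners off the face are back in place by the
  parity formula; the vertices of the face return by the pointwise condition in
  \<open>turn_closes\<close>.\<close>

lemma cell_boundaryE:
  assumes "\<zeta> \<in> cell_boundaries n T"
  obtains \<sigma> where "\<sigma> \<in> simplices T" "\<zeta> \<noteq> []" "dual_path T \<sigma> \<zeta> \<sigma>"
    "even_triangulation n T \<Longrightarrow> \<forall>w\<in>verts \<sigma>. projectivity T \<sigma> \<zeta> w = w"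
proof -
  obtain \<tau> e m where \<zeta>: "\<zeta> = turn_walk T \<tau> e m" "(\<tau>, e) \<in> flags n T" and c: "turn_closes T \<tau> e m"
    using assms by (auto simp: cell_boundaries_def flags_def)
  have m: "0 < m" "(turn T ^^ m) (\<tau>, e) = (\<tau>, e)" "\<And>w. w \<in> e \<Longrightarrow> fold (pairing T) \<zeta> w = w"
    using c \<zeta> by (auto simp: turn_closes_def)
  show thesis
  proof
    show "simplex_of T \<tau> \<in> simplices T" using simplex_of_simplices[OF flag_facet[OF \<zeta>(2)]] by simp
    show "\<zeta> \<noteq> []" using \<zeta>(1) m(1) by (simp add: turn_walk_def)
    show "dual_path T (simplex_of T \<tau>) \<zeta> (simplex_of T \<tau>)"
      using dual_path_turn_walk[OF \<zeta>(2), of m] m(2) \<zeta>(1) by simp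
    assume "even_triangulation n T"
    then have "even m" using even_turn_period[OF _ \<zeta>(2) m(1,2)] by blast
    then show "\<forall>w\<in>verts (simplex_of T \<tau>). projectivity T (simplex_of T \<tau>) \<zeta> w = w"
      using projectivity_turn_walk[OF \<zeta>(2), where m = m] m(2,3) \<zeta>(1) flip(6)[OF \<zeta>(2)] verts_mem[of _ e]
      by (auto simp: Let_def)
  qed
qed

end

section \<open>The canonical symmetric representation\<close>

definition loop_move ::
    "nat \<Rightarrow> 'a::euclidean_space triangulation \<Rightarrow> 'a set \<Rightarrow> 'a set list \<Rightarrow> 'a set list \<Rightarrow> bool" where
  "loop_move n T \<sigma> a b \<longleftrightarrow> a \<in> dual_loops T \<sigma> \<and> b \<in> dual_loops T \<sigma> \<and> elementary_move n T a b"

lemma loop_equiv_iff: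
  "(\<gamma>, \<delta>) \<in> loop_equiv n T \<sigma> \<longleftrightarrow> \<gamma> \<in> dual_loops T \<sigma> \<and> equivclp (loop_move n T \<sigma>) \<gamma> \<delta>"
proof -
  have "loop_move n T \<sigma> = (\<lambda>a b. a \<in> dual_loops T \<sigma> \<and> b \<in> dual_loops T \<sigma> \<and> elementary_move n T a b)"
    by (simp add: fun_eq_iff loop_move_def)
  then show ?thesis by (simp add: loop_equiv_def)
qed

context triangulated
begin

text \<open>A nonempty closed path begins with a facet of its base simplex, and a facet lies in only
  one simplex. Hence \<alpha> must end at \<rho>, and what remains after the excision is
  composable.\<close>

lemma dual_path_remove_loop:
  assumes path: "dual_path T \<sigma> (\<alpha> @ \<zeta> @ \<beta>) \<sigma>'" "\<sigma> \<in> simplices T"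
    and \<zeta>: "\<zeta> \<noteq> []" "dual_path T \<rho> \<zeta> \<rho>" "\<rho> \<in> simplices T"
  shows "dual_path T \<sigma> \<alpha> \<rho>" "dual_path T \<rho> \<beta> \<sigma>'"
proof -
  obtain \<rho>' where \<rho>': "dual_path T \<sigma> \<alpha> \<rho>'" "dual_path T \<rho>' (\<zeta> @ \<beta>) \<sigma>'"
    using path by (auto simp: dual_path_append)
  obtain \<tau> \<zeta>' where "\<zeta> = \<tau> # \<zeta>'" using \<zeta>(1) by (cases \<zeta>) auto
  then have "\<tau> facet_of \<rho>'" "\<tau> facet_of \<rho>" using \<rho>' \<zeta>(2) by auto
  then have "\<rho>' = \<rho>"
    using simplex_of_eq dual_path_simplices[OF \<rho>'(1) path(2)] \<zeta>(3) by metis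
  with \<rho>' show "dual_path T \<sigma> \<alpha> \<rho>" "dual_path T \<rho> \<beta> \<sigma>'"
    using \<zeta>(2) by (auto simp: dual_path_append dest: dual_path_unique)
qed

text \<open>Common form of both moves: a nonempty closed path is deleted whose projectivity is
  trivial for even triangulations. For backtracking this holds because the two perspectivities are
  mutually inverse, for cells because of the parity of turning.\<close>

lemma elementary_moveE:
  assumes "elementary_move n T a b"
  obtains \<alpha> \<zeta> \<beta> \<rho> where "a = \<alpha> @ \<zeta> @ \<beta>" "b = \<alpha> @ \<beta>" "\<zeta> \<noteq> []" "\<rho> \<in> simplices T" "dual_path T \<rho> \<zeta> \<rho>"
    "even_triangulation n T \<Longrightarrow> \<forall>w\<in>verts \<rho>. projectivity T \<rho> \<zeta> w = w"
  using assms
proof cases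
  case (backtrack \<tau> \<alpha> \<beta>)
  have "dual_path T (simplex_of T \<tau>) [\<tau>, mate T \<tau>] (simplex_of T \<tau>)"
    using backtrack(3) by (simp add: mate_mate facet_of_simplex_of mate_facets)
  moreover have "projectivity T (simplex_of T \<tau>) [\<tau>, mate T \<tau>] w = w" if "w \<in> verts (simplex_of T \<tau>)" for w
    using that perspectivity_mate[OF backtrack(3) that] perspectivity_mem[OF backtrack(3) that] backtrack(3)
    by (simp add: compose_eq mate_mate)
  ultimately show thesis
    using that[of \<alpha> "[\<tau>, mate T \<tau>]" \<beta> "simplex_of T \<tau>"] backtrack simplex_of_simplices by blast
next
  case (cell \<zeta> \<alpha> \<beta>)
  then show thesis using cell_boundaryE[OF cell(3)] that by metis
qed

lemma elementary_move_dual_path: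
  assumes "elementary_move n T a b" "\<sigma> \<in> simplices T" "dual_path T \<sigma> a \<sigma>'"
  shows "dual_path T \<sigma> b \<sigma>'"
  using assms(1)
proof (rule elementary_moveE)
  fix \<alpha> \<zeta> \<beta> \<rho>
  assume "a = \<alpha> @ \<zeta> @ \<beta>" "b = \<alpha> @ \<beta>" "\<zeta> \<noteq> []" "\<rho> \<in> simplices T" "dual_path T \<rho> \<zeta> \<rho>"
  then show ?thesis
    using dual_path_remove_loop[of \<sigma> \<alpha> \<zeta> \<beta> \<sigma>' \<rho>] assms by (auto simp: dual_path_append)
qed

lemma elementary_move_projectivity:
  assumes "elementary_move n T a b" "\<sigma> \<in> simplices T" "dual_path T \<sigma> a \<sigma>'" "even_triangulation n T"
  shows "projectivity T \<sigma> a = projectivity T \<sigma> b"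
  using assms(1)
proof (rule elementary_moveE)
  fix \<alpha> \<zeta> \<beta> \<rho>
  assume *: "a = \<alpha> @ \<zeta> @ \<beta>" "b = \<alpha> @ \<beta>" "\<zeta> \<noteq> []" "\<rho> \<in> simplices T" "dual_path T \<rho> \<zeta> \<rho>"
    "even_triangulation n T \<Longrightarrow> \<forall>w\<in>verts \<rho>. projectivity T \<rho> \<zeta> w = w"
  have \<alpha>: "dual_path T \<sigma> \<alpha> \<rho>"
    using dual_path_remove_loop[of \<sigma> \<alpha> \<zeta> \<beta> \<sigma>' \<rho>] assms * by auto
  show ?thesis
  proof (rule extensionalityI[OF projectivity_extensional projectivity_extensional])
    fix w assume w: "w \<in> verts \<sigma>"
    have "projectivity T \<sigma> \<alpha> w \<in> verts \<rho>"
      using projectivity_mem[OF \<alpha> assms(2) w] .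
    then show "projectivity T \<sigma> a w = projectivity T \<sigma> b w"
      using *(6)[OF assms(4)] projectivity_append[OF \<alpha> assms(2) w] projectivity_append[OF *(5,4)] *(1,2)
      by simp
  qed
qed

lemma elementary_move_append:
  assumes "elementary_move n T a b"
  shows "elementary_move n T (\<gamma> @ a @ \<delta>) (\<gamma> @ b @ \<delta>)"
  using assms
proof cases
  case (backtrack \<tau> \<alpha> \<beta>)
  then show ?thesis using elementary_move.backtrack[of \<tau> T n "\<gamma> @ \<alpha>" "\<beta> @ \<delta>"] by simp
next
  case (cell \<zeta> \<alpha> \<beta>)
  then show ?thesis using elementary_move.cell[of \<zeta> n T "\<gamma> @ \<alpha>" "\<beta> @ \<delta>"] by simp
qed

section \<open>Loop classes form a group\<close>

lemma dual_loops_append: "\<gamma> \<in> dual_loops T \<sigma> \<Longrightarrow> \<delta> \<in> dual_loops T \<sigma> \<Longrightarrow> \<gamma> @ \<delta> \<in> dual_loops T \<sigma>"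
  by (auto simp: dual_loops_def dual_path_append)

lemma equiv_loop_equiv: "equiv (dual_loops T \<sigma>) (loop_equiv n T \<sigma>)"
proof (rule equivI)
  have loop: "\<delta> \<in> dual_loops T \<sigma>" if "equivclp (loop_move n T \<sigma>) \<gamma> \<delta>" "\<gamma> \<in> dual_loops T \<sigma>" for \<gamma> \<delta>
    using that by induction (auto simp: loop_move_def)
  show "loop_equiv n T \<sigma> \<subseteq> dual_loops T \<sigma> \<times> dual_loops T \<sigma>"
    using loop by (auto simp: loop_equiv_iff)
  show "refl_on (dual_loops T \<sigma>) (loop_equiv n T \<sigma>)"
    by (auto simp: refl_on_def loop_equiv_iff)
  show "sym (loop_equiv n T \<sigma>)"
    using loop by (auto simp: sym_def loop_equiv_iff intro: equivclp_sym)
  show "trans (loop_equiv n T \<sigma>)"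
    by (auto simp: trans_def loop_equiv_iff intro: equivclp_trans)
qed

lemma loop_equivD: "(\<gamma>, \<delta>) \<in> loop_equiv n T \<sigma> \<Longrightarrow> \<gamma> \<in> dual_loops T \<sigma> \<and> \<delta> \<in> dual_loops T \<sigma>"
  using equiv_loop_equiv[of \<sigma>] by (auto simp: equiv_def refl_on_def)

lemma loop_equiv_append:
  assumes "(a, b) \<in> loop_equiv n T \<sigma>" "\<gamma> \<in> dual_loops T \<sigma>" "\<delta> \<in> dual_loops T \<sigma>"
  shows "(\<gamma> @ a @ \<delta>, \<gamma> @ b @ \<delta>) \<in> loop_equiv n T \<sigma>"
proof -
  have a: "a \<in> dual_loops T \<sigma>" "equivclp (loop_move n T \<sigma>) a b" using assms(1) by (auto simp: loop_equiv_iff)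
  have "equivclp (loop_move n T \<sigma>) (\<gamma> @ a @ \<delta>) (\<gamma> @ b @ \<delta>)"
    using a(2)
  proof induction
    case (step y z)
    have "loop_move n T \<sigma> (\<gamma> @ c @ \<delta>) (\<gamma> @ d @ \<delta>)" if "loop_move n T \<sigma> c d" for c d
      using that assms(2,3) by (simp add: loop_move_def dual_loops_append elementary_move_append)
    then show ?case using equivclp_into_equivclp[OF step.IH] step.hyps(2) by blast
  qed simp
  then show ?thesis
    using a(1) assms(2,3) dual_loops_append by (auto simp: loop_equiv_iff)
qed

lemma loop_class_eqI: "(\<gamma>, \<delta>) \<in> loop_equiv n T \<sigma> \<Longrightarrow> loop_class n T \<sigma> \<gamma> = loop_class n T \<sigma> \<delta>"
  unfolding loop_class_def using equiv_class_eq[OF equiv_loop_equiv] .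

lemma loop_class_carrier: "\<gamma> \<in> dual_loops T \<sigma> \<Longrightarrow> loop_class n T \<sigma> \<gamma> \<in> carrier (pi1 n T \<sigma>)"
  by (simp add: pi1_def loop_class_def quotientI)

lemma carrier_pi1E:
  assumes "A \<in> carrier (pi1 n T \<sigma>)"
  obtains \<gamma> where "\<gamma> \<in> dual_loops T \<sigma>" "A = loop_class n T \<sigma> \<gamma>"
  using assms by (auto simp: pi1_def loop_class_def elim: quotientE)

lemma Nil_dual_loops: "[] \<in> dual_loops T \<sigma>"
  by (simp add: dual_loops_def)

text \<open>The product is a union over all representatives; since concatenation respects
  equivalence, all members of the union coincide.\<close>

lemma mult_loop_class:
  assumes "\<gamma> \<in> dual_loops T \<sigma>" "\<delta> \<in> dual_loops T \<sigma>"
  shows "loop_class n T \<sigma> \<gamma> \<otimes>\<^bsub>pi1 n T \<sigma>\<^esub> loop_class n T \<sigma> \<delta> = loop_class n T \<sigma> (\<delta> @ \<gamma>)"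
proof -
  have "congruent2 (loop_equiv n T \<sigma>) (loop_equiv n T \<sigma>) (\<lambda>\<gamma> \<delta>. loop_class n T \<sigma> (\<delta> @ \<gamma>))"
  proof (rule congruent2I[OF equiv_loop_equiv equiv_loop_equiv])
    show "loop_class n T \<sigma> (w @ y) = loop_class n T \<sigma> (w @ z)"
      if "w \<in> dual_loops T \<sigma>" "(y, z) \<in> loop_equiv n T \<sigma>" for w y z
      using loop_equiv_append[OF that(2,1) Nil_dual_loops] by (simp add: loop_class_eqI)
    show "loop_class n T \<sigma> (y @ w) = loop_class n T \<sigma> (z @ w)"
      if "w \<in> dual_loops T \<sigma>" "(y, z) \<in> loop_equiv n T \<sigma>" for w y z
      using loop_equiv_append[OF that(2) Nil_dual_loops that(1)] by (simp add: loop_class_eqI)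
  qed
  from UN_equiv_class2[OF equiv_loop_equiv equiv_loop_equiv this assms]
  show ?thesis by (simp add: pi1_def loop_class_def)
qed

lemma one_pi1: "\<one>\<^bsub>pi1 n T \<sigma>\<^esub> = loop_class n T \<sigma> []"
  by (simp add: pi1_def)

text \<open>An edge is traversed backwards by crossing the mate of its facet. The reversed list will
  represent the inverse class.\<close>

lemma dual_path_rev:
  "dual_path T \<sigma> \<gamma> \<sigma>' \<Longrightarrow> \<sigma> \<in> simplices T \<Longrightarrow> dual_path T \<sigma>' (rev (map (mate T) \<gamma>)) \<sigma>"
proof (induction \<gamma> arbitrary: \<sigma>)
  case (Cons \<tau> \<gamma>)
  then have \<tau>: "\<tau> \<in> facets T" "simplex_of T \<tau> = \<sigma>" by (auto simp: facetsI simplex_of_eq)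
  then have "dual_path T \<sigma>' (rev (map (mate T) \<gamma>)) (simplex_of T (mate T \<tau>))"
    using Cons by (auto simp: mate_facets simplex_of_simplices)
  then show ?case using \<tau> by (auto simp: dual_path_append facet_of_simplex_of mate_facets mate_mate)
qed simp

text \<open>Cancellation takes place where the two lists meet, beginning with the first facet \<tau>
  of the path: the pair there is a backtrack at \<open>mate T \<tau>\<close>, whose own mate is
  \<tau>.\<close>

lemma elementary_moves_rev:
  assumes "set \<gamma> \<subseteq> facets T"
  shows "(elementary_move n T)\<^sup>*\<^sup>* (rev (map (mate T) \<gamma>) @ \<gamma>) []"
  using assms
proof (induction \<gamma>)
  case (Cons \<tau> \<gamma>)
  then have "elementary_move n T (rev (map (mate T) \<gamma>) @ [mate T \<tau>, mate T (mate T \<tau>)] @ \<gamma>) (rev (map (mate T) \<gamma>) @ \<gamma>)"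
    by (intro elementary_move.backtrack) (simp add: mate_facets)
  then show ?case using Cons by (simp add: mate_mate converse_rtranclp_into_rtranclp)
qed simp

lemma dual_path_facets: "dual_path T \<sigma> \<gamma> \<sigma>' \<Longrightarrow> \<sigma> \<in> simplices T \<Longrightarrow> set \<gamma> \<subseteq> facets T"
proof (induction \<gamma> arbitrary: \<sigma>)
  case (Cons \<tau> \<gamma>)
  then have "\<tau> \<in> facets T" by (auto simp: facetsI)
  then show ?case
    using Cons.IH[of "simplex_of T (mate T \<tau>)"] Cons.prems by (simp add: mate_facets simplex_of_simplices)
qed simp

text \<open>Moves preserve endpoints, so every intermediate list is again a loop, as
  \<open>loop_equiv\<close> demands.\<close>

lemma elementary_moves_loop_equiv:
  assumes "(elementary_move n T)\<^sup>*\<^sup>* a b" "\<sigma> \<in> simplices T" "a \<in> dual_loops T \<sigma>"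
  shows "(a, b) \<in> loop_equiv n T \<sigma>"
  using assms(1)
proof induction
  case base
  then show ?case using assms(3) by (simp add: loop_equiv_iff)
next
  case (step y z)
  have "y \<in> dual_loops T \<sigma>" using loop_equivD[OF step.IH] by blast
  then have "(y, z) \<in> loop_equiv n T \<sigma>"
    using elementary_move_dual_path[OF step.hyps(2) assms(2)] step.hyps(2)
    by (auto simp: loop_equiv_iff dual_loops_def loop_move_def)
  then show ?case
    using step.IH equiv_loop_equiv[of \<sigma>] by (meson equivE transE)
qed

lemma group_pi1:
  assumes "\<sigma> \<in> simplices T"
  shows "group (pi1 n T \<sigma>)"
proof (rule groupI)
  show "\<one>\<^bsub>pi1 n T \<sigma>\<^esub> \<in> carrier (pi1 n T \<sigma>)"
    unfolding one_pi1 by (rule loop_class_carrier[OF Nil_dual_loops])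
  fix A assume "A \<in> carrier (pi1 n T \<sigma>)"
  then obtain \<gamma> where \<gamma>: "\<gamma> \<in> dual_loops T \<sigma>" "A = loop_class n T \<sigma> \<gamma>" by (rule carrier_pi1E)
  show "\<one>\<^bsub>pi1 n T \<sigma>\<^esub> \<otimes>\<^bsub>pi1 n T \<sigma>\<^esub> A = A"
    using \<gamma> by (simp add: one_pi1 mult_loop_class Nil_dual_loops)
  show "\<exists>B\<in>carrier (pi1 n T \<sigma>). B \<otimes>\<^bsub>pi1 n T \<sigma>\<^esub> A = \<one>\<^bsub>pi1 n T \<sigma>\<^esub>"
  proof -
    \<comment> \<open>Products reverse concatenation, so a left inverse requires contracting
      \<gamma> followed by \<open>?\<beta>\<close>. The contraction lemma has the reversed list in
      front; it is therefore applied to \<open>?\<beta>\<close>, whose own reversal is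
      \<gamma>.\<close>
    let ?\<delta> = "rev (map (mate T) (rev (map (mate T) \<gamma>)))" and ?\<beta> = "rev (map (mate T) \<gamma>)"
    have f: "set \<gamma> \<subseteq> facets T" using \<gamma>(1) assms dual_path_facets by (auto simp: dual_loops_def)
    then have "map (\<lambda>\<tau>. mate T (mate T \<tau>)) \<gamma> = map (\<lambda>\<tau>. \<tau>) \<gamma>"
      by (intro map_cong) (auto simp: mate_mate)
    then have inv: "?\<delta> = \<gamma>" by (simp add: rev_map o_def)
    have \<beta>: "?\<beta> \<in> dual_loops T \<sigma>" using \<gamma>(1) assms dual_path_rev by (auto simp: dual_loops_def)
    have "(elementary_move n T)\<^sup>*\<^sup>* (\<gamma> @ ?\<beta>) []"
      using elementary_moves_rev[of ?\<beta>] inv f mate_facets by auto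
    then have "loop_class n T \<sigma> (\<gamma> @ ?\<beta>) = loop_class n T \<sigma> []"
      using elementary_moves_loop_equiv assms dual_loops_append[OF \<gamma>(1) \<beta>] loop_class_eqI by blast
    then have "loop_class n T \<sigma> ?\<beta> \<otimes>\<^bsub>pi1 n T \<sigma>\<^esub> A = \<one>\<^bsub>pi1 n T \<sigma>\<^esub>"
      using \<gamma> \<beta> mult_loop_class one_pi1 by simp
    then show ?thesis using loop_class_carrier[OF \<beta>] by blast
  qed
  fix B assume "B \<in> carrier (pi1 n T \<sigma>)"
  then obtain \<delta> where \<delta>: "\<delta> \<in> dual_loops T \<sigma>" "B = loop_class n T \<sigma> \<delta>" by (rule carrier_pi1E)
  show "A \<otimes>\<^bsub>pi1 n T \<sigma>\<^esub> B \<in> carrier (pi1 n T \<sigma>)"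
    using \<gamma> \<delta> by (simp add: mult_loop_class loop_class_carrier dual_loops_append)
  fix C assume "C \<in> carrier (pi1 n T \<sigma>)"
  then obtain \<epsilon> where \<epsilon>: "\<epsilon> \<in> dual_loops T \<sigma>" "C = loop_class n T \<sigma> \<epsilon>" by (rule carrier_pi1E)
  show "A \<otimes>\<^bsub>pi1 n T \<sigma>\<^esub> B \<otimes>\<^bsub>pi1 n T \<sigma>\<^esub> C = A \<otimes>\<^bsub>pi1 n T \<sigma>\<^esub> (B \<otimes>\<^bsub>pi1 n T \<sigma>\<^esub> C)"
    using \<gamma> \<delta> \<epsilon> by (simp add: mult_loop_class dual_loops_append)
qed

text \<open>Moves in either direction leave the projectivity unchanged, so it is constant on the
  class and \<open>the_elem\<close> reads off its single value.\<close>

lemma canonical_rep_loop_class: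
  assumes "\<sigma> \<in> simplices T" "even_triangulation n T" "\<gamma> \<in> dual_loops T \<sigma>"
  shows "canonical_rep T \<sigma> (loop_class n T \<sigma> \<gamma>) = projectivity T \<sigma> \<gamma>"
proof -
  have "projectivity T \<sigma> \<delta> = projectivity T \<sigma> \<gamma>" if "equivclp (loop_move n T \<sigma>) \<gamma> \<delta>" for \<delta>
    using that
  proof induction
    case (step y z)
    then show ?case
      using elementary_move_projectivity assms(1,2) unfolding loop_move_def dual_loops_def
      by (metis mem_Collect_eq)
  qed simp
  then have "projectivity T \<sigma> \<delta> = projectivity T \<sigma> \<gamma>" if "\<delta> \<in> loop_class n T \<sigma> \<gamma>" for \<delta>
    using that unfolding loop_class_def Image_singleton_iff loop_equiv_iff by blast
  moreover have "\<gamma> \<in> loop_class n T \<sigma> \<gamma>"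
    using assms(3) by (simp add: loop_class_def loop_equiv_iff)
  ultimately have "projectivity T \<sigma> ` loop_class n T \<sigma> \<gamma> = {projectivity T \<sigma> \<gamma>}"
    by blast
  then show ?thesis by (simp add: canonical_rep_def)
qed

lemma projectivity_Bij:
  "\<sigma> \<in> simplices T \<Longrightarrow> \<gamma> \<in> dual_loops T \<sigma> \<Longrightarrow> projectivity T \<sigma> \<gamma> \<in> Bij (verts \<sigma>)"
  using projectivity_extensional projectivity_bij by (auto simp: Bij_def dual_loops_def)

lemma group_hom_canonical_rep:
  assumes "\<sigma> \<in> simplices T" "even_triangulation n T"
  shows "group_hom (pi1 n T \<sigma>) (BijGroup (verts \<sigma>)) (canonical_rep T \<sigma>)"
proof (intro group_hom.intro group_hom_axioms.intro group_pi1[OF assms(1)] group_BijGroup homI)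
  fix A assume "A \<in> carrier (pi1 n T \<sigma>)"
  then obtain \<gamma> where \<gamma>: "\<gamma> \<in> dual_loops T \<sigma>" "A = loop_class n T \<sigma> \<gamma>" by (rule carrier_pi1E)
  show "canonical_rep T \<sigma> A \<in> carrier (BijGroup (verts \<sigma>))"
    using canonical_rep_loop_class[OF assms] \<gamma> projectivity_Bij[OF assms(1)] by (simp add: BijGroup_def)
  fix B assume "B \<in> carrier (pi1 n T \<sigma>)"
  then obtain \<delta> where \<delta>: "\<delta> \<in> dual_loops T \<sigma>" "B = loop_class n T \<sigma> \<delta>" by (rule carrier_pi1E)
  have "projectivity T \<sigma> (\<delta> @ \<gamma>) = compose (verts \<sigma>) (projectivity T \<sigma> \<gamma>) (projectivity T \<sigma> \<delta>)"
    using projectivity_append[OF _ assms(1)] \<delta>(1)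
    by (intro extensionalityI[OF projectivity_extensional compose_extensional])
       (auto simp: compose_eq dual_loops_def)
  then show "canonical_rep T \<sigma> (A \<otimes>\<^bsub>pi1 n T \<sigma>\<^esub> B)
      = canonical_rep T \<sigma> A \<otimes>\<^bsub>BijGroup (verts \<sigma>)\<^esub> canonical_rep T \<sigma> B"
    using canonical_rep_loop_class[OF assms] \<gamma> \<delta> projectivity_Bij[OF assms(1)] dual_loops_append
    by (simp add: BijGroup_def mult_loop_class)
qed

text \<open>Pigeonhole for the n + 1 vertices of \<sigma>. The 0-skeleton is finite, so the bound is
  not met merely by the default value 0 of \<open>card\<close> on infinite sets.\<close>

lemma exists_identified_vertices:
  assumes "\<sigma> \<in> simplices T" "card (skeleton T 0) < n + 1"
  obtains v v' where "v \<in> verts \<sigma>" "v' \<in> verts \<sigma>" "v \<noteq> v'" "quotient_proj T v = quotient_proj T v'"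
proof -
  have "quotient_proj T ` verts \<sigma> \<subseteq> skeleton T 0"
    using assms(1) by (auto simp: skeleton_0)
  then have "card (quotient_proj T ` verts \<sigma>) < card (verts \<sigma>)"
    using card_mono[OF finite_skeleton_0] card_verts[OF assms(1)] assms(2) by (metis le_less_trans)
  then show thesis
    using pigeonhole[of "quotient_proj T" "verts \<sigma>"] that by (auto simp: inj_on_def)
qed

end

theorem proposition8:
  fixes n :: nat and T :: "'a::euclidean_space triangulation" and \<sigma>\<^sub>0 :: "'a set"
  assumes "n \<ge> 3" and "is_triangulation n T" and "\<sigma>\<^sub>0 \<in> simplices T"
  shows "(\<forall>v\<in>verts \<sigma>\<^sub>0. \<forall>v'\<in>verts \<sigma>\<^sub>0. quotient_proj T v = quotient_proj T v' \<longrightarrow>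
            (\<exists>\<gamma>\<in>dual_loops T \<sigma>\<^sub>0.
               loop_in (punctured_space T) (quotient_proj T (barycentre \<sigma>\<^sub>0)) (dual_curve T \<sigma>\<^sub>0 \<gamma>) \<and>
               loop_class n T \<sigma>\<^sub>0 \<gamma> \<in> carrier (pi1 n T \<sigma>\<^sub>0) \<and>
               projectivity T \<sigma>\<^sub>0 \<gamma> v = v'))
       \<and> (even_triangulation n T \<and> card (skeleton T 0) < n + 1 \<longrightarrow>
            group_hom (pi1 n T \<sigma>\<^sub>0) (BijGroup (verts \<sigma>\<^sub>0)) (canonical_rep T \<sigma>\<^sub>0) \<and>
            (\<forall>\<gamma>\<in>dual_loops T \<sigma>\<^sub>0.
               canonical_rep T \<sigma>\<^sub>0 (loop_class n T \<sigma>\<^sub>0 \<gamma>) = projectivity T \<sigma>\<^sub>0 \<gamma>) \<and>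
            canonical_rep T \<sigma>\<^sub>0 ` carrier (pi1 n T \<sigma>\<^sub>0) \<noteq> {\<one>\<^bsub>BijGroup (verts \<sigma>\<^sub>0)\<^esub>} \<and>
            carrier (pi1 n T \<sigma>\<^sub>0) \<noteq> {\<one>\<^bsub>pi1 n T \<sigma>\<^sub>0\<^esub>})"
proof -
  interpret triangulated n T
    using assms(1,2) by unfold_locales
  show ?thesis
  proof (intro conjI ballI impI)
    fix v v' assume "v \<in> verts \<sigma>\<^sub>0" "v' \<in> verts \<sigma>\<^sub>0" "quotient_proj T v = quotient_proj T v'"
    then show "\<exists>\<gamma>\<in>dual_loops T \<sigma>\<^sub>0.
        loop_in (punctured_space T) (quotient_proj T (barycentre \<sigma>\<^sub>0)) (dual_curve T \<sigma>\<^sub>0 \<gamma>) \<and>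
        loop_class n T \<sigma>\<^sub>0 \<gamma> \<in> carrier (pi1 n T \<sigma>\<^sub>0) \<and> projectivity T \<sigma>\<^sub>0 \<gamma> v = v'"
      using exists_dual_loop[OF assms(3)] loop_in_dual_curve[OF assms(3)] loop_class_carrier by blast
  next
    assume "even_triangulation n T \<and> card (skeleton T 0) < n + 1"
    then have ev: "even_triangulation n T" and few: "card (skeleton T 0) < n + 1" by auto
    show hom: "group_hom (pi1 n T \<sigma>\<^sub>0) (BijGroup (verts \<sigma>\<^sub>0)) (canonical_rep T \<sigma>\<^sub>0)"
      using group_hom_canonical_rep[OF assms(3) ev] .
    show rep: "canonical_rep T \<sigma>\<^sub>0 (loop_class n T \<sigma>\<^sub>0 \<gamma>) = projectivity T \<sigma>\<^sub>0 \<gamma>"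
      if "\<gamma> \<in> dual_loops T \<sigma>\<^sub>0" for \<gamma>
      using canonical_rep_loop_class[OF assms(3) ev that] .
    obtain v v' where v: "v \<in> verts \<sigma>\<^sub>0" "v' \<in> verts \<sigma>\<^sub>0" "v \<noteq> v'" "quotient_proj T v = quotient_proj T v'"
      using exists_identified_vertices[OF assms(3) few] .
    then obtain \<gamma> where \<gamma>: "\<gamma> \<in> dual_loops T \<sigma>\<^sub>0" "projectivity T \<sigma>\<^sub>0 \<gamma> v = v'"
      using exists_dual_loop[OF assms(3)] by blast
    \<comment> \<open>The identity of \<open>BijGroup\<close> fixes every vertex, whereas this loop
      moves \<open>v\<close> to a different vertex.\<close>
    have "canonical_rep T \<sigma>\<^sub>0 (loop_class n T \<sigma>\<^sub>0 \<gamma>) \<noteq> \<one>\<^bsub>BijGroup (verts \<sigma>\<^sub>0)\<^esub>"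
      using rep[OF \<gamma>(1)] \<gamma>(2) v by (auto simp: BijGroup_def)
    then show image: "canonical_rep T \<sigma>\<^sub>0 ` carrier (pi1 n T \<sigma>\<^sub>0) \<noteq> {\<one>\<^bsub>BijGroup (verts \<sigma>\<^sub>0)\<^esub>}"
      using loop_class_carrier[OF \<gamma>(1)] by blast
    show "carrier (pi1 n T \<sigma>\<^sub>0) \<noteq> {\<one>\<^bsub>pi1 n T \<sigma>\<^sub>0\<^esub>}"
      using image group_hom.hom_one[OF hom] by auto
  qed
qed

end
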